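(* Let $R$ be a commutative ring. Let $d,q_1,q_2\in R^{\times}$ be non zero-divisors such that $dR+q_2R=R$, and let $Q_1,Q_2\in R[y]$ be polynomials such that $\phi_d(q_2y+Q_2(Q_1(y)))=0$. Set $F(x,y)=d^{-1}\{q_2y+Q_2(q_1dx+Q_1(y))\}\in R[x,y]$. The following assertions are equivalent: i) $F(x,y)\in \mathrm{VA}_2(R)$; ii) a) $\phi_{q_1}(F(x,y))\in \mathrm{VA}_2(R/q_1R)$ and b) $\phi_{q_2}(F(x,y))\in \mathrm{VA}_2(R/q_2R)$; iii) a) $\phi_{q_1}(F(0,y))\in \mathrm{VA}_1(R/q_1R)$ and b) $\phi_{q_2}(Q_2(y))\in \mathrm{VA}_1(R/q_2R)$.
   Context: For a commutative ring $R$, $R^{\times}$ denotes the set of non zero-divisors of $R$. $\mathrm{GA}_1(R)$ is the group of automorphisms of the $R$-algebra $R[y]$ and $\mathrm{GA}_2(R)$ is the group of automorphisms of the $R$-algebra $R[x,y]$. The sets of coordinates are $\mathrm{VA}_1(R)=\{P\in R[y] : \exists \sigma\in \mathrm{GA}_1(R),\ \sigma(y)=P\}$ and $\mathrm{VA}_2(R)=\{F\in R[x,y] : \exists \sigma\in \mathrm{GA}_2(R),\ \sigma(y)=F\}$. For $p\in R$, $\phi_p$ denotes the canonical map $R\to R/pR$ and its coefficientwise extension to $R[x,y]\to (R/pR)[x,y]$ (and $R[y]\to (R/pR)[y]$). *)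

theory Defs
  imports "HOL-Algebra.UnivPoly" "HOL-Algebra.QuotRing"
begin

text \<open>
  The ring \<open>R[y]\<close> is \<open>UP R\<close>, and \<open>R[x,y]\<close> is represented as \<open>R[y][x]\<close>, i.e. as
  \<open>UP (UP R)\<close>: the inner variable is \<open>y\<close>, the outer one is \<open>x\<close>.
  The zero ring is a \<open>cring\<close>; this matters, since \<open>R/pR\<close> is zero when \<open>p\<close> is a unit.
\<close>

definition non_zero_divisors :: "('a, 'm) ring_scheme \<Rightarrow> 'a set" where
  "non_zero_divisors R =
     {a \<in> carrier R. \<forall>b \<in> carrier R. a \<otimes>\<^bsub>R\<^esub> b = \<zero>\<^bsub>R\<^esub> \<longrightarrow> b = \<zero>\<^bsub>R\<^esub>}"

abbreviation poly1 :: "('a, 'm) ring_scheme \<Rightarrow> ('a, nat \<Rightarrow> 'a) up_ring" where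
  "poly1 R \<equiv> UP R"

abbreviation poly2 ::
  "('a, 'm) ring_scheme \<Rightarrow> (nat \<Rightarrow> 'a, nat \<Rightarrow> nat \<Rightarrow> 'a) up_ring" where
  "poly2 R \<equiv> UP (UP R)"

definition const1 :: "('a, 'm) ring_scheme \<Rightarrow> 'a \<Rightarrow> nat \<Rightarrow> 'a" where
  "const1 R a = monom (poly1 R) a 0"

definition var1 :: "('a, 'm) ring_scheme \<Rightarrow> nat \<Rightarrow> 'a" where
  "var1 R = monom (poly1 R) \<one>\<^bsub>R\<^esub> 1"

definition incl_y :: "('a, 'm) ring_scheme \<Rightarrow> (nat \<Rightarrow> 'a) \<Rightarrow> nat \<Rightarrow> nat \<Rightarrow> 'a" where
  "incl_y R P = monom (poly2 R) P 0"

definition const2 :: "('a, 'm) ring_scheme \<Rightarrow> 'a \<Rightarrow> nat \<Rightarrow> nat \<Rightarrow> 'a" where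
  "const2 R a = incl_y R (const1 R a)"

definition var_x :: "('a, 'm) ring_scheme \<Rightarrow> nat \<Rightarrow> nat \<Rightarrow> 'a" where
  "var_x R = monom (poly2 R) \<one>\<^bsub>poly1 R\<^esub> 1"

definition var_y :: "('a, 'm) ring_scheme \<Rightarrow> nat \<Rightarrow> nat \<Rightarrow> 'a" where
  "var_y R = incl_y R (var1 R)"

text \<open>\<open>subst1 R P A\<close> is \<open>P(A) \<in> R[y]\<close> and \<open>subst2 R P A\<close> is \<open>P(A) \<in> R[x,y]\<close>,
  for \<open>P \<in> R[y]\<close>.\<close>

definition subst1 ::
  "('a, 'm) ring_scheme \<Rightarrow> (nat \<Rightarrow> 'a) \<Rightarrow> (nat \<Rightarrow> 'a) \<Rightarrow> nat \<Rightarrow> 'a" where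
  "subst1 R P A = eval R (poly1 R) (const1 R) A P"

definition subst2 ::
  "('a, 'm) ring_scheme \<Rightarrow> (nat \<Rightarrow> 'a) \<Rightarrow> (nat \<Rightarrow> nat \<Rightarrow> 'a) \<Rightarrow> nat \<Rightarrow> nat \<Rightarrow> 'a" where
  "subst2 R P A = eval R (poly2 R) (const2 R) A P"

text \<open>\<open>F(0,y)\<close>, for \<open>F(x,y) \<in> R[x,y]\<close>.\<close>

definition at_x0 :: "('a, 'm) ring_scheme \<Rightarrow> (nat \<Rightarrow> nat \<Rightarrow> 'a) \<Rightarrow> nat \<Rightarrow> 'a" where
  "at_x0 R F = eval (poly1 R) (poly1 R) (\<lambda>P. P) \<zero>\<^bsub>poly1 R\<^esub> F"

definition GA1 :: "('a, 'm) ring_scheme \<Rightarrow> ((nat \<Rightarrow> 'a) \<Rightarrow> (nat \<Rightarrow> 'a)) set" where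
  "GA1 R = {\<sigma> \<in> ring_iso (poly1 R) (poly1 R).
              \<forall>a \<in> carrier R. \<sigma> (const1 R a) = const1 R a}"

definition GA2 ::
  "('a, 'm) ring_scheme \<Rightarrow> ((nat \<Rightarrow> nat \<Rightarrow> 'a) \<Rightarrow> (nat \<Rightarrow> nat \<Rightarrow> 'a)) set" where
  "GA2 R = {\<sigma> \<in> ring_iso (poly2 R) (poly2 R).
              \<forall>a \<in> carrier R. \<sigma> (const2 R a) = const2 R a}"

definition VA1 :: "('a, 'm) ring_scheme \<Rightarrow> (nat \<Rightarrow> 'a) set" where
  "VA1 R = {P \<in> carrier (poly1 R). \<exists>\<sigma> \<in> GA1 R. \<sigma> (var1 R) = P}"

definition VA2 :: "('a, 'm) ring_scheme \<Rightarrow> (nat \<Rightarrow> nat \<Rightarrow> 'a) set" where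
  "VA2 R = {F \<in> carrier (poly2 R). \<exists>\<sigma> \<in> GA2 R. \<sigma> (var_y R) = F}"

definition quot :: "('a, 'm) ring_scheme \<Rightarrow> 'a \<Rightarrow> 'a set ring" where
  "quot R p = R Quot (PIdl\<^bsub>R\<^esub> p)"

definition phi :: "('a, 'm) ring_scheme \<Rightarrow> 'a \<Rightarrow> 'a \<Rightarrow> 'a set" where
  "phi R p a = PIdl\<^bsub>R\<^esub> p +>\<^bsub>R\<^esub> a"

definition phi1 :: "('a, 'm) ring_scheme \<Rightarrow> 'a \<Rightarrow> (nat \<Rightarrow> 'a) \<Rightarrow> nat \<Rightarrow> 'a set" where
  "phi1 R p P = (\<lambda>n. phi R p (coeff (poly1 R) P n))"

definition phi2 ::
  "('a, 'm) ring_scheme \<Rightarrow> 'a \<Rightarrow> (nat \<Rightarrow> nat \<Rightarrow> 'a) \<Rightarrow> nat \<Rightarrow> nat \<Rightarrow> 'a set" where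
  "phi2 R p F = (\<lambda>n. phi1 R p (coeff (poly2 R) F n))"

text \<open>\<open>d\<^sup>-\<^sup>1 G\<close>: the element \<open>F\<close> of \<open>R[x,y]\<close> with \<open>d F = G\<close>. It is
  unique if \<open>d\<close> is not a zero-divisor, and exists if \<open>d\<close> divides all coefficients of \<open>G\<close>;
  outside this case the value is unspecified.\<close>

definition div_const ::
  "('a, 'm) ring_scheme \<Rightarrow> 'a \<Rightarrow> (nat \<Rightarrow> nat \<Rightarrow> 'a) \<Rightarrow> nat \<Rightarrow> nat \<Rightarrow> 'a" where
  "div_const R d G =
     (THE F. F \<in> carrier (poly2 R) \<and> const2 R d \<otimes>\<^bsub>poly2 R\<^esub> F = G)"

lemma coeff_const2_mult:
  assumes "cring R" "d \<in> carrier R" "F \<in> carrier (poly2 R)"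
  shows "coeff (poly1 R) (coeff (poly2 R) (const2 R d \<otimes>\<^bsub>poly2 R\<^esub> F) m) n =
         d \<otimes>\<^bsub>R\<^esub> coeff (poly1 R) (coeff (poly2 R) F m) n"
proof -
  interpret P: UP_cring R "UP R" using assms(1) by (simp add: UP_cring_def)
  interpret Q: UP_cring "UP R" "UP (UP R)" using P.UP_cring by (simp add: UP_cring_def)
  show ?thesis
    using assms(2,3)
    by (simp add: const2_def const1_def incl_y_def Q.monom_mult_is_smult P.monom_mult_is_smult)
qed

lemma div_const_eq:
  assumes R: "cring R" and d: "d \<in> non_zero_divisors R"
    and F: "F \<in> carrier (poly2 R)" and eq: "const2 R d \<otimes>\<^bsub>poly2 R\<^esub> F = G"
  shows "div_const R d G = F"
  unfolding div_const_def
proof (rule the_equality)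
  show "F \<in> carrier (poly2 R) \<and> const2 R d \<otimes>\<^bsub>poly2 R\<^esub> F = G" using F eq by simp
next
  fix F' assume F': "F' \<in> carrier (poly2 R) \<and> const2 R d \<otimes>\<^bsub>poly2 R\<^esub> F' = G"
  interpret P: UP_cring R "UP R" using R by (simp add: UP_cring_def)
  interpret Q: UP_cring "UP R" "UP (UP R)" using P.UP_cring by (simp add: UP_cring_def)
  have dR: "d \<in> carrier R" using d by (simp add: non_zero_divisors_def)
  show "F' = F"
  proof (rule Q.up_eqI)
    fix m
    show "coeff (UP (UP R)) F' m = coeff (UP (UP R)) F m"
    proof (rule P.up_eqI)
      fix n
      define a where "a = coeff (UP R) (coeff (UP (UP R)) F' m) n"
      define b where "b = coeff (UP R) (coeff (UP (UP R)) F m) n"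
      have ab: "a \<in> carrier R" "b \<in> carrier R" using F F' by (auto simp: a_def b_def)
      have "d \<otimes>\<^bsub>R\<^esub> a = d \<otimes>\<^bsub>R\<^esub> b"
        using coeff_const2_mult[OF R dR, of F m n] coeff_const2_mult[OF R dR, of F' m n] F F' eq
        by (simp add: a_def b_def)
      hence "d \<otimes>\<^bsub>R\<^esub> (a \<ominus>\<^bsub>R\<^esub> b) = \<zero>\<^bsub>R\<^esub>"
        using ab dR by (simp add: P.R.minus_eq P.R.r_distr P.R.r_minus P.R.r_neg)
      hence "a \<ominus>\<^bsub>R\<^esub> b = \<zero>\<^bsub>R\<^esub>" using d ab by (simp add: non_zero_divisors_def)
      thus "coeff (UP R) (coeff (UP (UP R)) F' m) n = coeff (UP R) (coeff (UP (UP R)) F m) n"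
        using ab P.R.minus_equality[of a "\<ominus>\<^bsub>R\<^esub> b"]
        by (simp add: P.R.minus_eq a_def b_def)
    qed (use F F' in auto)
  qed (use F F' in auto)
qed

end

theory Submission
  imports Defs
begin

text \<open>Write \<open>F(x, y) = F0(q1 x, y)\<close> with \<open>F0 = d\<^sup>-\<^sup>1 (q2 y + Q2(d x + Q1(y)))\<close>, so that
  \<open>F(0, y) = F0(0, y)\<close>. If \<open>Q2\<close> is a coordinate modulo \<open>q2\<close>, an explicit pair of mutually inverse
  substitutions shows that \<open>F0\<close> is a coordinate, whatever \<open>q1\<close> is; and if \<open>F0\<close> is a coordinate and
  \<open>F0(0, y)\<close> is one modulo \<open>q1\<close>, then \<open>F0(q1 x, y)\<close> is a coordinate. Conversely, modulo \<open>q1\<close> one has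
  \<open>F = F(0, y)\<close>, and modulo \<open>q2\<close> one has \<open>d F = Q2(L)\<close> with \<open>d\<close> a unit. So in both cases an
  automorphism sending \<open>F\<close> to \<open>y\<close> gives an identity \<open>W(H) = y\<close> with \<open>W\<close> in one variable and
  \<open>H\<close> in two. Setting \<open>x = 0\<close> there makes \<open>W\<close> one-sided invertible for composition, which in one
  variable is already enough to be a coordinate.\<close>

section \<open>Homomorphisms out of polynomial rings\<close>

text \<open>Degree arguments fail here, since \<open>R\<close> and its quotients may have nilpotents
  and a quotient may be zero. Automorphisms are therefore certified by polynomial identities, which
  survive reduction and further substitution. The recurrent device is this: a congruence modulo a
  constant \<open>c\<close> yields a polynomial quotient by \<open>c\<close>. Substitutions fix
  \<open>c\<close>, so an identity for the quotient follows by substituting into its defining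
  equation and cancelling \<open>c\<close>, which is where non-zero-divisors enter. The comaximality
  of \<open>d\<close> and \<open>q2\<close> is read in two ways. That \<open>d\<close> is invertible
  modulo \<open>q2\<close> serves the passage from \<open>F\<close> to \<open>Q2\<close>. That
  \<open>q2\<close> is invertible modulo \<open>d\<close> turns the hypothesis on
  \<open>Q2(Q1(y))\<close> into invertibility of \<open>Q1\<close> modulo \<open>d\<close>, which
  provides the division by \<open>d\<close> in the inverse of the automorphism completing
  \<open>F0\<close>. Nothing relates \<open>q1\<close> to \<open>d\<close> or \<open>q2\<close>, so
  \<open>q1\<close> is treated separately, as a rescaling of \<open>x\<close>.\<close>

lemma UP_cringI: "cring R \<Longrightarrow> UP_cring R"
  by (simp add: UP_cring_def)

lemma cring_UP: "cring R \<Longrightarrow> cring (UP R)"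
  using UP_cring.UP_cring[OF UP_cringI] by auto

lemma univ_propI:
  "cring R \<Longrightarrow> cring S \<Longrightarrow> c \<in> ring_hom R S \<Longrightarrow> UP_pre_univ_prop R S c"
  by (intro UP_pre_univ_prop.intro ring_hom_cring.intro ring_hom_cring_axioms.intro UP_cringI)

lemma const1_hom: "cring R \<Longrightarrow> const1 R \<in> ring_hom R (UP R)"
  using UP_ring.const_ring_hom[of R] 
  by (simp add: UP_ring_def cring.axioms(1) const1_def[abs_def])

lemma const1_closed [simp]: "cring R \<Longrightarrow> a \<in> carrier R \<Longrightarrow> const1 R a \<in> carrier (UP R)"
  by (rule ring_hom_closed[OF const1_hom])

lemma var1_closed [simp]:
  assumes "cring R"
  shows "var1 R \<in> carrier (UP R)"
proof -
  interpret UP_cring R "UP R" by (rule UP_cringI[OF assms])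
  show ?thesis unfolding var1_def by (rule monom_closed[OF R.one_closed])
qed

lemma eval_hom:
  assumes "cring R" "cring S" "c \<in> ring_hom R S" "s \<in> carrier S"
  shows "eval R S c s \<in> ring_hom (UP R) S"
  by (rule UP_pre_univ_prop.eval_ring_hom[OF univ_propI[OF assms(1-3)] assms(4)])

lemma eval_const1:
  assumes "cring R" "cring S" "c \<in> ring_hom R S" "s \<in> carrier S" "a \<in> carrier R"
  shows "eval R S c s (const1 R a) = c a"
  unfolding const1_def by (rule UP_pre_univ_prop.eval_const[OF univ_propI[OF assms(1-3)] assms(4,5)])

lemma eval_var1:
  assumes "cring R" "cring S" "c \<in> ring_hom R S" "s \<in> carrier S"
  shows "eval R S c s (var1 R) = s"
  unfolding var1_def by (rule UP_pre_univ_prop.eval_monom1[OF univ_propI[OF assms(1-3)] assms(4)])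

text \<open>Uniqueness in the universal property, with the coefficient map taken to be the
  restriction of \<open>f\<close> to constants. Substitution laws below reduce to comparing values
  on constants and variables, with no induction on polynomials.\<close>

lemma UP_hom_eqI:
  assumes "cring R" "cring S" "f \<in> ring_hom (UP R) S" "g \<in> ring_hom (UP R) S"
    and "\<And>a. a \<in> carrier R \<Longrightarrow> f (const1 R a) = g (const1 R a)"
    and "f (var1 R) = g (var1 R)" "P \<in> carrier (UP R)"
  shows "f P = g P"
proof -
  have c: "(\<lambda>a. f (const1 R a)) \<in> ring_hom R S"
    using ring_hom_trans[OF const1_hom[OF assms(1)] assms(3)] by (simp add: comp_def)
  interpret U: UP_pre_univ_prop R S "\<lambda>a. f (const1 R a)" "UP R" by (rule univ_propI[OF assms(1,2) c])
  show ?thesis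
  proof (rule U.UP_hom_unique[OF _ _ _ _ _ _ assms(7)])
    show "ring_hom_cring (UP R) S f" "ring_hom_cring (UP R) S g"
      using assms cring_UP by (auto intro!: ring_hom_cring.intro ring_hom_cring_axioms.intro)
    show "f (monom (UP R) \<one>\<^bsub>R\<^esub> (Suc 0)) = f (var1 R)" by (simp add: var1_def)
    show "g (monom (UP R) \<one>\<^bsub>R\<^esub> (Suc 0)) = f (var1 R)" using assms(6) by (simp add: var1_def)
    show "f (var1 R) \<in> carrier S" using assms(6) ring_hom_closed[OF assms(4) var1_closed[OF assms(1)]] by simp
  qed (use assms(5) in \<open>auto simp: const1_def\<close>)
qed

text \<open>Naturality of evaluation. The composition laws for \<open>subst1\<close> and
  \<open>subst2\<close> are instances of it, with \<open>h\<close> itself a substitution or an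
  inclusion.\<close>

lemma hom_eval:
  assumes "cring R" "cring S" "cring T" "c \<in> ring_hom R S" "s \<in> carrier S" "h \<in> ring_hom S T"
    and "c' \<in> ring_hom R T" "\<And>a. a \<in> carrier R \<Longrightarrow> h (c a) = c' a" "P \<in> carrier (UP R)"
  shows "h (eval R S c s P) = eval R T c' (h s) P"
proof -
  have hs: "h s \<in> carrier T" by (rule ring_hom_closed[OF assms(6,5)])
  have "(h \<circ> eval R S c s) P = eval R T c' (h s) P"
    by (rule UP_hom_eqI[OF assms(1,3) ring_hom_trans[OF eval_hom assms(6)] eval_hom])
      (use assms hs in \<open>auto simp: eval_const1 eval_var1\<close>)
  thus ?thesis by simp
qed

lemma incl_y_eq: "incl_y R = const1 (UP R)"
  by (simp add: incl_y_def[abs_def] const1_def[abs_def])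

lemma const2_eq: "const2 R a = const1 (UP R) (const1 R a)"
  by (simp add: const2_def incl_y_eq)

lemma var_x_eq: "var_x R = var1 (UP R)"
  by (simp add: var_x_def var1_def)

lemma var_y_eq: "var_y R = const1 (UP R) (var1 R)"
  by (simp add: var_y_def incl_y_eq)

lemma incl_y_hom: "cring R \<Longrightarrow> incl_y R \<in> ring_hom (UP R) (poly2 R)"
  by (simp add: incl_y_eq const1_hom cring_UP)

lemma const2_hom: "cring R \<Longrightarrow> const2 R \<in> ring_hom R (poly2 R)"
  using ring_hom_trans[OF const1_hom incl_y_hom] by (simp add: comp_def const2_def[abs_def])

lemma poly2_closed [simp]:
  assumes "cring R"
  shows "var_x R \<in> carrier (poly2 R)" "var_y R \<in> carrier (poly2 R)"
    "a \<in> carrier R \<Longrightarrow> const2 R a \<in> carrier (poly2 R)"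
    "P \<in> carrier (UP R) \<Longrightarrow> incl_y R P \<in> carrier (poly2 R)"
  using assms by (simp_all add: var_x_eq var_y_eq const2_eq incl_y_eq cring_UP)

lemma poly2_hom_eqI:
  assumes "cring R" "cring S" "f \<in> ring_hom (poly2 R) S" "g \<in> ring_hom (poly2 R) S"
    and "\<And>a. a \<in> carrier R \<Longrightarrow> f (const2 R a) = g (const2 R a)"
    and "f (var_x R) = g (var_x R)" "f (var_y R) = g (var_y R)" "P \<in> carrier (poly2 R)"
  shows "f P = g P"
proof (rule UP_hom_eqI[OF cring_UP[OF assms(1)] assms(2-4) _ _ assms(8)])
  fix Q assume Q: "Q \<in> carrier (UP R)"
  have "(f \<circ> incl_y R) Q = (g \<circ> incl_y R) Q"
    by (rule UP_hom_eqI[OF assms(1,2) ring_hom_trans[OF incl_y_hom assms(3)]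
          ring_hom_trans[OF incl_y_hom assms(4)]])
      (use assms Q in \<open>auto simp: const2_def var_y_def\<close>)
  thus "f (const1 (UP R) Q) = g (const1 (UP R) Q)" by (simp add: incl_y_eq)
qed (use assms in \<open>simp add: var_x_eq\<close>)

section \<open>Evaluation in two variables and specialization at \<open>x = 0\<close>\<close>

definition eval2 ::
  "('a, 'm) ring_scheme \<Rightarrow> ('b, 'n) ring_scheme \<Rightarrow> ('a \<Rightarrow> 'b) \<Rightarrow> 'b \<Rightarrow> 'b \<Rightarrow> (nat \<Rightarrow> nat \<Rightarrow> 'a) \<Rightarrow> 'b"
  where "eval2 R S c s t = eval (UP R) S (eval R S c t) s"

lemma
  assumes "cring R" "cring S" "c \<in> ring_hom R S" "s \<in> carrier S" "t \<in> carrier S"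
  shows eval2_hom: "eval2 R S c s t \<in> ring_hom (poly2 R) S"
    and eval2_incl_y: "P \<in> carrier (UP R) \<Longrightarrow> eval2 R S c s t (incl_y R P) = eval R S c t P"
    and eval2_const2: "a \<in> carrier R \<Longrightarrow> eval2 R S c s t (const2 R a) = c a"
    and eval2_var_x: "eval2 R S c s t (var_x R) = s"
    and eval2_var_y: "eval2 R S c s t (var_y R) = t"
proof -
  have e: "eval R S c t \<in> ring_hom (UP R) S" by (rule eval_hom[OF assms(1-3,5)])
  note h = cring_UP[OF assms(1)] assms(2) e assms(4)
  show "eval2 R S c s t \<in> ring_hom (poly2 R) S"
    unfolding eval2_def by (rule eval_hom[OF h])
  show i: "eval2 R S c s t (incl_y R P) = eval R S c t P" if "P \<in> carrier (UP R)" for P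
    unfolding eval2_def incl_y_eq by (rule eval_const1[OF h that])
  show "eval2 R S c s t (const2 R a) = c a" if "a \<in> carrier R"
    unfolding const2_def i[OF const1_closed[OF assms(1) that]]
    by (rule eval_const1[OF assms(1-3,5) that])
  show "eval2 R S c s t (var_x R) = s"
    unfolding eval2_def var_x_eq by (rule eval_var1[OF h])
  show "eval2 R S c s t (var_y R) = t"
    unfolding var_y_def i[OF var1_closed[OF assms(1)]]
    by (rule eval_var1[OF assms(1-3,5)])
qed

lemma hom_eval2:
  assumes "cring R" "cring S" "cring T" "c \<in> ring_hom R S" "s \<in> carrier S" "t \<in> carrier S"
    and "h \<in> ring_hom S T"
    and "c' \<in> ring_hom R T" "\<And>a. a \<in> carrier R \<Longrightarrow> h (c a) = c' a" "P \<in> carrier (poly2 R)"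
  shows "h (eval2 R S c s t P) = eval2 R T c' (h s) (h t) P"
proof -
  have hs: "h s \<in> carrier T" "h t \<in> carrier T"
    by (rule ring_hom_closed[OF assms(7,5)], rule ring_hom_closed[OF assms(7,6)])
  have "(h \<circ> eval2 R S c s t) P = eval2 R T c' (h s) (h t) P"
    by (rule poly2_hom_eqI[OF assms(1,3) ring_hom_trans[OF eval2_hom assms(7)] eval2_hom])
      (use assms hs in \<open>auto simp: eval2_const2 eval2_var_x eval2_var_y\<close>)
  thus ?thesis by simp
qed

lemma at_x0_hom: "cring R \<Longrightarrow> at_x0 R \<in> ring_hom (poly2 R) (UP R)"
  using eval_hom[of "UP R" "UP R" "\<lambda>P. P" "\<zero>\<^bsub>UP R\<^esub>"] id_ring_hom[of "UP R"]
  by (simp add: at_x0_def[abs_def] cring_UP id_def cring.cring_simprules(2))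

lemma
  assumes R: "cring R"
  shows at_x0_var_x: "at_x0 R (var_x R) = \<zero>\<^bsub>UP R\<^esub>"
    and at_x0_incl_y: "P \<in> carrier (UP R) \<Longrightarrow> at_x0 R (incl_y R P) = P"
    and at_x0_var_y: "at_x0 R (var_y R) = var1 R"
    and at_x0_const2: "a \<in> carrier R \<Longrightarrow> at_x0 R (const2 R a) = const1 R a"
proof -
  have id: "(\<lambda>P. P) \<in> ring_hom (UP R) (UP R)" using id_ring_hom[of "UP R"] by (simp add: id_def)
  have z: "\<zero>\<^bsub>UP R\<^esub> \<in> carrier (UP R)" using cring.cring_simprules(2)[OF cring_UP[OF R]] .
  show "at_x0 R (var_x R) = \<zero>\<^bsub>UP R\<^esub>"
    by (simp add: at_x0_def var_x_eq eval_var1 cring_UP R id z)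
  show i: "at_x0 R (incl_y R P) = P" if "P \<in> carrier (UP R)" for P
    using that by (simp add: at_x0_def incl_y_eq eval_const1 cring_UP R id z)
  show "at_x0 R (var_y R) = var1 R"
    using i R by (simp add: var_y_def)
  show "at_x0 R (const2 R a) = const1 R a" if "a \<in> carrier R" for a
    using i that R by (simp add: const2_def)
qed

section \<open>Substitution into polynomials in one variable and its composition laws\<close>

lemma
  assumes "cring R" "A \<in> carrier (UP R)"
  shows subst1_hom: "(\<lambda>P. subst1 R P A) \<in> ring_hom (UP R) (UP R)"
    and subst1_closed [simp]: "P \<in> carrier (UP R) \<Longrightarrow> subst1 R P A \<in> carrier (UP R)"
    and subst1_const1: "a \<in> carrier R \<Longrightarrow> subst1 R (const1 R a) A = const1 R a"
    and subst1_var1: "subst1 R (var1 R) A = A"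
proof -
  note h = assms(1) cring_UP[OF assms(1)] const1_hom[OF assms(1)] assms(2)
  show s: "(\<lambda>P. subst1 R P A) \<in> ring_hom (UP R) (UP R)"
    using eval_hom[OF h] by (simp add: subst1_def[abs_def])
  show "P \<in> carrier (UP R) \<Longrightarrow> subst1 R P A \<in> carrier (UP R)"
    using ring_hom_closed[OF s] by simp
  show "a \<in> carrier R \<Longrightarrow> subst1 R (const1 R a) A = const1 R a"
    unfolding subst1_def by (rule eval_const1[OF h])
  show "subst1 R (var1 R) A = A"
    unfolding subst1_def by (rule eval_var1[OF h])
qed

lemma
  assumes "cring R" "A \<in> carrier (poly2 R)"
  shows subst2_hom: "(\<lambda>P. subst2 R P A) \<in> ring_hom (UP R) (poly2 R)"
    and subst2_closed [simp]: "P \<in> carrier (UP R) \<Longrightarrow> subst2 R P A \<in> carrier (poly2 R)"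
    and subst2_const1: "a \<in> carrier R \<Longrightarrow> subst2 R (const1 R a) A = const2 R a"
    and subst2_var1: "subst2 R (var1 R) A = A"
proof -
  note h = assms(1) cring_UP[OF cring_UP[OF assms(1)]] const2_hom[OF assms(1)] assms(2)
  show s: "(\<lambda>P. subst2 R P A) \<in> ring_hom (UP R) (poly2 R)"
    using eval_hom[OF h] by (simp add: subst2_def[abs_def])
  show "P \<in> carrier (UP R) \<Longrightarrow> subst2 R P A \<in> carrier (poly2 R)"
    using ring_hom_closed[OF s] by simp
  show "a \<in> carrier R \<Longrightarrow> subst2 R (const1 R a) A = const2 R a"
    unfolding subst2_def by (rule eval_const1[OF h])
  show "subst2 R (var1 R) A = A"
    unfolding subst2_def by (rule eval_var1[OF h])
qed

lemma subst1_subst1: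
  assumes "cring R" "P \<in> carrier (UP R)" "A \<in> carrier (UP R)" "B \<in> carrier (UP R)"
  shows "subst1 R (subst1 R P A) B = subst1 R P (subst1 R A B)"
  using hom_eval[where h = "\<lambda>P. subst1 R P B", OF assms(1) cring_UP[OF assms(1)] cring_UP[OF assms(1)] const1_hom[OF assms(1)]
      assms(3) subst1_hom[OF assms(1,4)] const1_hom[OF assms(1)] subst1_const1[OF assms(1,4)]
      assms(2)]
  unfolding subst1_def .

lemma subst1_var1_right:
  assumes "cring R" "P \<in> carrier (UP R)"
  shows "subst1 R P (var1 R) = P"
proof -
  have "subst1 R P (var1 R) = id P"
    by (rule UP_hom_eqI[OF assms(1) cring_UP[OF assms(1)] subst1_hom[OF assms(1)]])
      (use assms in \<open>simp_all add: subst1_const1 subst1_var1 id_ring_hom[unfolded id_def]\<close>)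
  thus ?thesis by simp
qed

lemma hom_subst2:
  assumes "cring R" "cring T" "h \<in> ring_hom (poly2 R) T" "c \<in> ring_hom R T"
    and "\<And>a. a \<in> carrier R \<Longrightarrow> h (const2 R a) = c a"
    and "P \<in> carrier (UP R)" "A \<in> carrier (poly2 R)"
  shows "h (subst2 R P A) = eval R T c (h A) P"
  unfolding subst2_def
  by (rule hom_eval[where h = h and c' = c, OF assms(1) cring_UP[OF cring_UP[OF assms(1)]] assms(2)
        const2_hom[OF assms(1)] assms(7,3,4,5,6)])

lemma subst2_incl_y:
  assumes "cring R" "P \<in> carrier (UP R)" "A \<in> carrier (UP R)"
  shows "subst2 R P (incl_y R A) = incl_y R (subst1 R P A)"
  unfolding subst1_def subst2_def
  by (rule sym, rule hom_eval[OF assms(1) cring_UP[OF assms(1)] cring_UP[OF cring_UP[OF assms(1)]]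
        const1_hom[OF assms(1)] assms(3) incl_y_hom[OF assms(1)] const2_hom[OF assms(1)] _ assms(2)])
    (simp add: const2_def)

lemma subst2_var_y:
  assumes "cring R" "P \<in> carrier (UP R)"
  shows "subst2 R P (var_y R) = incl_y R P"
  using subst2_incl_y[OF assms var1_closed[OF assms(1)]] subst1_var1_right[OF assms]
  by (simp add: var_y_def)

lemma subst2_subst1:
  assumes "cring R" "P \<in> carrier (UP R)" "A \<in> carrier (UP R)" "B \<in> carrier (poly2 R)"
  shows "subst2 R (subst1 R P A) B = subst2 R P (subst2 R A B)"
  using hom_eval[where h = "\<lambda>P. subst2 R P B", OF assms(1) cring_UP[OF assms(1)] cring_UP[OF cring_UP[OF assms(1)]]
      const1_hom[OF assms(1)]
      assms(3) subst2_hom[OF assms(1,4)] const2_hom[OF assms(1)] subst2_const1[OF assms(1,4)]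
      assms(2)]
  unfolding subst1_def subst2_def .

lemma at_x0_subst2:
  assumes "cring R" "P \<in> carrier (UP R)" "A \<in> carrier (poly2 R)"
  shows "at_x0 R (subst2 R P A) = subst1 R P (at_x0 R A)"
  unfolding subst1_def
  by (rule hom_subst2[OF assms(1) cring_UP[OF assms(1)] at_x0_hom[OF assms(1)] const1_hom[OF assms(1)]
        at_x0_const2[OF assms(1)] assms(2,3)])

section \<open>Constant terms, division by \<open>y\<close>, and injectivity of substitution\<close>

lemma coeff_0_hom: "cring R \<Longrightarrow> (\<lambda>P. coeff (UP R) P 0) \<in> ring_hom (UP R) R"
proof (rule ring_hom_memI, goal_cases)
  case (1 P)
  interpret UP_cring R "UP R" by (rule UP_cringI[OF 1(1)])
  show ?case using 1 by simp
next
  case (2 P Q)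
  interpret UP_cring R "UP R" by (rule UP_cringI[OF 2(1)])
  show ?case using 2 by simp
next
  case (3 P Q)
  interpret UP_cring R "UP R" by (rule UP_cringI[OF 3(1)])
  show ?case using 3 by simp
next
  case 4
  interpret UP_cring R "UP R" by (rule UP_cringI[OF 4])
  show ?case by simp
qed

lemma coeff_const1:
  assumes "cring R" "a \<in> carrier R"
  shows "coeff (UP R) (const1 R a) n = (if n = 0 then a else \<zero>\<^bsub>R\<^esub>)"
proof -
  interpret UP_cring R "UP R" by (rule UP_cringI[OF assms(1)])
  show ?thesis using assms by (simp add: const1_def)
qed

lemma coeff_var1_mult:
  assumes "cring R" "P \<in> carrier (UP R)"
  shows "coeff (UP R) (var1 R \<otimes>\<^bsub>UP R\<^esub> P) n = (case n of 0 \<Rightarrow> \<zero>\<^bsub>R\<^esub> | Suc m \<Rightarrow> coeff (UP R) P m)"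
proof -
  interpret UP_cring R "UP R" by (rule UP_cringI[OF assms(1)])
  show ?thesis
  proof (cases n)
    case 0
    thus ?thesis using assms by (simp add: var1_def)
  next
    case (Suc m)
    have "coeff (UP R) (var1 R \<otimes>\<^bsub>UP R\<^esub> P) (m + 1) = \<one>\<^bsub>R\<^esub> \<otimes>\<^bsub>R\<^esub> coeff (UP R) P m"
      unfolding var1_def by (rule coeff_monom_mult[OF R.one_closed assms(2)])
    thus ?thesis using assms Suc by simp
  qed
qed

lemma var1_mult_eq_zeroD:
  assumes "cring R" "P \<in> carrier (UP R)" "var1 R \<otimes>\<^bsub>UP R\<^esub> P = \<zero>\<^bsub>UP R\<^esub>"
  shows "P = \<zero>\<^bsub>UP R\<^esub>"
proof -
  interpret UP_cring R "UP R" by (rule UP_cringI[OF assms(1)])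
  show ?thesis
  proof (rule up_eqI[OF _ assms(2) UP_zero_closed])
    fix n
    show "coeff (UP R) P n = coeff (UP R) \<zero>\<^bsub>UP R\<^esub> n"
      using coeff_var1_mult[OF assms(1,2), of "Suc n"] assms(3) by simp
  qed
qed

text \<open>Splitting \<open>P = P(0) + y P'\<close> makes induction on the index of a coefficient
  possible: coefficient \<open>Suc n\<close> of \<open>P\<close> is coefficient \<open>n\<close> of
  \<open>P'\<close>. This takes the place of induction on the degree.\<close>

lemma UP_decompose:
  assumes "cring R" "P \<in> carrier (UP R)"
  shows "\<exists>P' \<in> carrier (UP R). (\<forall>n. coeff (UP R) P' n = coeff (UP R) P (Suc n)) \<and>
    P = const1 R (coeff (UP R) P 0) \<oplus>\<^bsub>UP R\<^esub> var1 R \<otimes>\<^bsub>UP R\<^esub> P'"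
proof -
  interpret UP_cring R "UP R" by (rule UP_cringI[OF assms(1)])
  define P' where "P' = (\<lambda>n. P (Suc n))"
  have P: "P \<in> up R" using assms(2) by (simp add: UP_def)
  then obtain N where N: "bound \<zero>\<^bsub>R\<^esub> N P" by blast
  have "bound \<zero>\<^bsub>R\<^esub> N P'"
    using N by (auto simp: bound_def P'_def)
  hence P': "P' \<in> up R" using P by (auto simp: P'_def)
  hence P'c: "P' \<in> carrier (UP R)" by (simp add: UP_def)
  have c: "coeff (UP R) P' n = coeff (UP R) P (Suc n)" for n
    using P P' by (simp add: UP_def P'_def)
  have "P = const1 R (coeff (UP R) P 0) \<oplus>\<^bsub>UP R\<^esub> var1 R \<otimes>\<^bsub>UP R\<^esub> P'"
    by (rule up_eqI)
      (use P'c assms in \<open>simp_all add: coeff_var1_mult coeff_const1 c split: nat.split\<close>)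
  with P'c c show ?thesis by blast
qed

text \<open>A polynomial with unit constant term is invertible as a power series, hence no
  zero-divisor. The elementary form of this: the constant term of \<open>G\<close> vanishes, so
  \<open>G = y G'\<close>, and cancelling \<open>y\<close> leaves the same equation for
  \<open>G'\<close>.\<close>

lemma mult_eq_zero_unit_coeff_0:
  assumes R: "cring R" and k: "k \<in> carrier (UP R)"
    and u: "u \<in> carrier R" "u \<otimes>\<^bsub>R\<^esub> coeff (UP R) k 0 = \<one>\<^bsub>R\<^esub>"
    and G: "G \<in> carrier (UP R)" "k \<otimes>\<^bsub>UP R\<^esub> G = \<zero>\<^bsub>UP R\<^esub>"
  shows "G = \<zero>\<^bsub>UP R\<^esub>"
proof -
  interpret UP_cring R "UP R" by (rule UP_cringI[OF R])
  have z: "coeff (UP R) G 0 = \<zero>\<^bsub>R\<^esub>" if G: "G \<in> carrier (UP R)" "k \<otimes>\<^bsub>UP R\<^esub> G = \<zero>\<^bsub>UP R\<^esub>" for G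
  proof -
    have "coeff (UP R) k 0 \<otimes>\<^bsub>R\<^esub> coeff (UP R) G 0 = \<zero>\<^bsub>R\<^esub>"
      using ring_hom_mult[OF coeff_0_hom[OF R] k G(1)] G by simp
    hence "u \<otimes>\<^bsub>R\<^esub> coeff (UP R) k 0 \<otimes>\<^bsub>R\<^esub> coeff (UP R) G 0 = \<zero>\<^bsub>R\<^esub>"
      using R.m_assoc[OF u(1) coeff_closed[OF k] coeff_closed[OF G(1)], of 0 0] u(1) by simp
    thus ?thesis unfolding u(2) using G by simp
  qed
  have "coeff (UP R) G n = \<zero>\<^bsub>R\<^esub>" if "G \<in> carrier (UP R)" "k \<otimes>\<^bsub>UP R\<^esub> G = \<zero>\<^bsub>UP R\<^esub>" for n G
    using that
  proof (induction n arbitrary: G)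
    case 0 thus ?case by (rule z)
  next
    case (Suc n)
    obtain G' where G': "G' \<in> carrier (UP R)" "\<And>n. coeff (UP R) G' n = coeff (UP R) G (Suc n)"
      "G = const1 R (coeff (UP R) G 0) \<oplus>\<^bsub>UP R\<^esub> var1 R \<otimes>\<^bsub>UP R\<^esub> G'"
      using UP_decompose[OF R Suc.prems(1)] by blast
    have G: "G = var1 R \<otimes>\<^bsub>UP R\<^esub> G'"
      using G'(3) z[OF Suc.prems] G'(1) R by (simp add: const1_def)
    have "var1 R \<otimes>\<^bsub>UP R\<^esub> (k \<otimes>\<^bsub>UP R\<^esub> G') = \<zero>\<^bsub>UP R\<^esub>"
      using Suc.prems(2) k G'(1) R unfolding G by (simp add: P.m_lcomm)
    hence "k \<otimes>\<^bsub>UP R\<^esub> G' = \<zero>\<^bsub>UP R\<^esub>"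
      using k G'(1) by (rule_tac var1_mult_eq_zeroD[OF R]) auto
    thus ?case using Suc.IH[of G'] G' by simp
  qed
  thus ?thesis using G by (intro up_eqI) auto
qed

lemma subst1_const1_plus_var1_mult:
  assumes R: "cring R" and k: "k \<in> carrier (UP R)" and a: "a \<in> carrier R" and Z: "Z \<in> carrier (UP R)"
  shows "subst1 R (const1 R a \<oplus>\<^bsub>UP R\<^esub> var1 R \<otimes>\<^bsub>UP R\<^esub> Z) (var1 R \<otimes>\<^bsub>UP R\<^esub> k) =
    const1 R a \<oplus>\<^bsub>UP R\<^esub> var1 R \<otimes>\<^bsub>UP R\<^esub> (k \<otimes>\<^bsub>UP R\<^esub> subst1 R Z (var1 R \<otimes>\<^bsub>UP R\<^esub> k))"
proof -
  interpret UP_cring R "UP R" by (rule UP_cringI[OF R])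
  have h: "var1 R \<otimes>\<^bsub>UP R\<^esub> k \<in> carrier (UP R)" using k R by simp
  show ?thesis
    using R k a Z h
    by (simp add: ring_hom_add[OF subst1_hom[OF R h]] ring_hom_mult[OF subst1_hom[OF R h]]
        subst1_const1 subst1_var1 P.m_assoc)
qed

text \<open>A polynomial \<open>y k\<close> with unit linear coefficient has a compositional inverse
  as a power series, so substituting it is injective. Here too constant terms are peeled off;
  besides \<open>y\<close>, the factor \<open>k\<close> has to be cancelled, by
  \<open>mult_eq_zero_unit_coeff_0\<close>.\<close>

lemma subst1_eq_zero_imp:
  assumes R: "cring R" and k: "k \<in> carrier (UP R)"
    and u: "u \<in> carrier R" "u \<otimes>\<^bsub>R\<^esub> coeff (UP R) k 0 = \<one>\<^bsub>R\<^esub>"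
    and Z: "Z \<in> carrier (UP R)" "subst1 R Z (var1 R \<otimes>\<^bsub>UP R\<^esub> k) = \<zero>\<^bsub>UP R\<^esub>"
  shows "Z = \<zero>\<^bsub>UP R\<^esub>"
proof -
  interpret UP_cring R "UP R" by (rule UP_cringI[OF R])
  define h where "h = var1 R \<otimes>\<^bsub>UP R\<^esub> k"
  have h: "h \<in> carrier (UP R)" using k R by (simp add: h_def)
  have dec: "subst1 R Z h = const1 R (coeff (UP R) Z 0) \<oplus>\<^bsub>UP R\<^esub> var1 R \<otimes>\<^bsub>UP R\<^esub> (k \<otimes>\<^bsub>UP R\<^esub> subst1 R Z' h)"
    if "Z' \<in> carrier (UP R)" "Z \<in> carrier (UP R)"
      "Z = const1 R (coeff (UP R) Z 0) \<oplus>\<^bsub>UP R\<^esub> var1 R \<otimes>\<^bsub>UP R\<^esub> Z'" for Z Z'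
  proof -
    have "subst1 R Z h = subst1 R (const1 R (coeff (UP R) Z 0) \<oplus>\<^bsub>UP R\<^esub> var1 R \<otimes>\<^bsub>UP R\<^esub> Z') h"
      using arg_cong[OF that(3), of "\<lambda>P. subst1 R P h"] .
    also have "\<dots> = const1 R (coeff (UP R) Z 0) \<oplus>\<^bsub>UP R\<^esub> var1 R \<otimes>\<^bsub>UP R\<^esub> (k \<otimes>\<^bsub>UP R\<^esub> subst1 R Z' h)"
      unfolding h_def by (rule subst1_const1_plus_var1_mult[OF R k coeff_closed[OF that(2)] that(1)])
    finally show ?thesis .
  qed
  have "coeff (UP R) Z n = \<zero>\<^bsub>R\<^esub>" if "Z \<in> carrier (UP R)" "subst1 R Z h = \<zero>\<^bsub>UP R\<^esub>" for n Z
    using that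
  proof (induction n arbitrary: Z)
    case (0 Z)
    obtain Z' where Z': "Z' \<in> carrier (UP R)" 
      "Z = const1 R (coeff (UP R) Z 0) \<oplus>\<^bsub>UP R\<^esub> var1 R \<otimes>\<^bsub>UP R\<^esub> Z'"
      using UP_decompose[OF R 0(1)] by blast
    \<comment> \<open>Since \<open>h\<close> has no constant term, substituting it preserves
      constant terms.\<close>
    have "coeff (UP R) (subst1 R Z h) 0 = coeff (UP R) Z 0"
      unfolding dec[OF Z'(1) 0(1) Z'(2)]
      using Z'(1) 0(1) R h k by (simp add: coeff_const1 coeff_var1_mult del: coeff_mult)
    thus ?case using 0 by simp
  next
    case (Suc n Z)
    obtain Z' where Z': "Z' \<in> carrier (UP R)" "\<And>n. coeff (UP R) Z' n = coeff (UP R) Z (Suc n)"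
      "Z = const1 R (coeff (UP R) Z 0) \<oplus>\<^bsub>UP R\<^esub> var1 R \<otimes>\<^bsub>UP R\<^esub> Z'"
      using UP_decompose[OF R Suc.prems(1)] by blast
    have "coeff (UP R) (subst1 R Z h) 0 = coeff (UP R) Z 0"
      unfolding dec[OF Z'(1) Suc.prems(1) Z'(3)]
      using Z'(1) Suc.prems(1) R h k by (simp add: coeff_const1 coeff_var1_mult del: coeff_mult)
    hence z0: "coeff (UP R) Z 0 = \<zero>\<^bsub>R\<^esub>" using Suc.prems by simp
    have z: "const1 R (coeff (UP R) Z 0) = \<zero>\<^bsub>UP R\<^esub>" by (simp add: z0 const1_def)
    have "var1 R \<otimes>\<^bsub>UP R\<^esub> (k \<otimes>\<^bsub>UP R\<^esub> subst1 R Z' h) = \<zero>\<^bsub>UP R\<^esub>"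
      using dec[OF Z'(1) Suc.prems(1) Z'(3)] Suc.prems(2) Z'(1) R h k by (simp add: z)
    hence "k \<otimes>\<^bsub>UP R\<^esub> subst1 R Z' h = \<zero>\<^bsub>UP R\<^esub>"
      using Z'(1) R h k by (rule_tac var1_mult_eq_zeroD[OF R]) auto
    hence "subst1 R Z' h = \<zero>\<^bsub>UP R\<^esub>"
      using Z'(1) R h by (rule_tac mult_eq_zero_unit_coeff_0[OF R k u]) auto
    thus ?case using Suc.IH[OF Z'(1)] Z'(2) by simp
  qed
  thus ?thesis using Z by (intro up_eqI) (auto simp: h_def)
qed

section \<open>Coordinates and inverse substitutions\<close>

lemma ring_hom_minus:
  assumes "cring R" "cring S" "h \<in> ring_hom R S" "a \<in> carrier R" "b \<in> carrier R"
  shows "h (a \<ominus>\<^bsub>R\<^esub> b) = h a \<ominus>\<^bsub>S\<^esub> h b"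
proof -
  interpret ring_hom_cring R S h
    using assms by (auto intro: ring_hom_cring.intro ring_hom_cring_axioms.intro)
  show ?thesis using assms by (simp add: a_minus_def)
qed

lemma (in ring) minus_eq_zeroD:
  assumes "a \<ominus> b = \<zero>" "a \<in> carrier R" "b \<in> carrier R"
  shows "a = b"
proof -
  have "a = (a \<ominus> b) \<oplus> b" using assms(2,3) by (simp add: a_minus_def a_assoc l_neg)
  thus ?thesis using assms by simp
qed

lemma subst1_left_inverse_aux:
  assumes R: "cring R" and W: "W \<in> carrier (UP R)" and h: "h \<in> carrier (UP R)"
    and h0: "coeff (UP R) h 0 = \<zero>\<^bsub>R\<^esub>" and Wh: "subst1 R W h = var1 R"
  shows "subst1 R h W = var1 R"
proof -
  interpret UP_cring R "UP R" by (rule UP_cringI[OF R])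
  obtain k where k: "k \<in> carrier (UP R)"
    "h = const1 R (coeff (UP R) h 0) \<oplus>\<^bsub>UP R\<^esub> var1 R \<otimes>\<^bsub>UP R\<^esub> k"
    using UP_decompose[OF R h] by blast
  have hk: "h = var1 R \<otimes>\<^bsub>UP R\<^esub> k" using k R by (simp add: h0 const1_def)
  obtain W' where W': "W' \<in> carrier (UP R)"
    "W = const1 R (coeff (UP R) W 0) \<oplus>\<^bsub>UP R\<^esub> var1 R \<otimes>\<^bsub>UP R\<^esub> W'"
    using UP_decompose[OF R W] by blast
  \<comment> \<open>Comparing the coefficients of \<open>y\<close> in \<open>W(h) = y\<close>, where
    \<open>W(h) = W(0) + y k W'(h)\<close>, shows that this is the inverse of the linear coefficient
    of \<open>h\<close>.\<close>
  define u where "u = coeff (UP R) (subst1 R W' h) 0"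
  have "subst1 R W h = subst1 R (const1 R (coeff (UP R) W 0) \<oplus>\<^bsub>UP R\<^esub> var1 R \<otimes>\<^bsub>UP R\<^esub> W') h"
    using arg_cong[OF W'(2), of "\<lambda>P. subst1 R P h"] .
  also have "\<dots> = const1 R (coeff (UP R) W 0) \<oplus>\<^bsub>UP R\<^esub> var1 R \<otimes>\<^bsub>UP R\<^esub> (k \<otimes>\<^bsub>UP R\<^esub> subst1 R W' h)"
    unfolding hk by (rule subst1_const1_plus_var1_mult[OF R k(1) coeff_closed[OF W] W'(1)])
  finally have "coeff (UP R) (const1 R (coeff (UP R) W 0) \<oplus>\<^bsub>UP R\<^esub> var1 R \<otimes>\<^bsub>UP R\<^esub> (k \<otimes>\<^bsub>UP R\<^esub> subst1 R W' h)) 1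
      = \<one>\<^bsub>R\<^esub>"
    by (simp add: Wh) (simp add: var1_def)
  hence "coeff (UP R) (k \<otimes>\<^bsub>UP R\<^esub> subst1 R W' h) 0 = \<one>\<^bsub>R\<^esub>"
    using R W k(1) h W'(1) by (simp add: coeff_const1 coeff_var1_mult del: coeff_mult)
  hence "coeff (UP R) k 0 \<otimes>\<^bsub>R\<^esub> u = \<one>\<^bsub>R\<^esub>"
    using ring_hom_mult[OF coeff_0_hom[OF R], of k "subst1 R W' h"] R k(1) W'(1) h
    by (simp add: u_def del: coeff_mult)
  moreover have u: "u \<in> carrier R" using R W'(1) h by (simp add: u_def)
  ultimately have uk: "u \<otimes>\<^bsub>R\<^esub> coeff (UP R) k 0 = \<one>\<^bsub>R\<^esub>"
    using k(1) by (simp add: R.m_comm)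
  \<comment> \<open>Substituting \<open>h\<close> into \<open>h(W) - y\<close> gives
    \<open>h(W(h)) - h = 0\<close>, so injectivity yields \<open>h(W) = y\<close>.\<close>
  have "subst1 R (subst1 R h W \<ominus>\<^bsub>UP R\<^esub> var1 R) h
      = subst1 R (subst1 R h W) h \<ominus>\<^bsub>UP R\<^esub> subst1 R (var1 R) h"
    using R W h cring_UP[OF R]
    by (intro ring_hom_minus[where h = "\<lambda>P. subst1 R P h", OF cring_UP[OF R] cring_UP[OF R] subst1_hom]) auto
  also have "\<dots> = h \<ominus>\<^bsub>UP R\<^esub> h"
    using R W h by (simp add: subst1_subst1 Wh subst1_var1_right subst1_var1)
  also have "\<dots> = \<zero>\<^bsub>UP R\<^esub>" using h by (simp add: a_minus_def P.r_neg)
  finally have "subst1 R h W \<ominus>\<^bsub>UP R\<^esub> var1 R = \<zero>\<^bsub>UP R\<^esub>"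
    using subst1_eq_zero_imp[OF R k(1) u uk, folded hk] R W h by simp
  thus ?thesis by (rule P.minus_eq_zeroD) (use R W h in simp_all)
qed

text \<open>The composition monoid of \<open>R[y]\<close> is Dedekind finite: after a translation \<open>h\<close> has no
  constant term, and then \<open>W(h) = y\<close> makes its linear coefficient a unit, so that substitution of
  \<open>h\<close> is injective.\<close>

lemma subst1_left_inverse:
  assumes R: "cring R" and W: "W \<in> carrier (UP R)" and h: "h \<in> carrier (UP R)"
    and Wh: "subst1 R W h = var1 R"
  shows "subst1 R h W = var1 R"
proof -
  interpret UP_cring R "UP R" by (rule UP_cringI[OF R])
  \<comment> \<open>The translations \<open>s\<close> and \<open>t\<close> are mutually inverse and
    \<open>s(k) = h\<close>, so the pair \<open>(W, h)\<close> may be replaced by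
    \<open>(W(s), k)\<close>, where \<open>k\<close> has no constant term.\<close>
  define c where "c = const1 R (coeff (UP R) h 0)"
  define k where "k = h \<ominus>\<^bsub>UP R\<^esub> c"
  define s where "s = var1 R \<oplus>\<^bsub>UP R\<^esub> c"
  define t where "t = var1 R \<ominus>\<^bsub>UP R\<^esub> c"
  have c: "c \<in> carrier (UP R)" using R h by (simp add: c_def)
  have kst: "k \<in> carrier (UP R)" "s \<in> carrier (UP R)" "t \<in> carrier (UP R)"
    using R h c by (simp_all add: k_def s_def t_def)
  have cancel: "(a \<ominus>\<^bsub>UP R\<^esub> c) \<oplus>\<^bsub>UP R\<^esub> c = a" if "a \<in> carrier (UP R)" for a
    using that c by (simp add: a_minus_def P.a_assoc P.l_neg)
  have cA: "subst1 R c a = c" if "a \<in> carrier (UP R)" for a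
    using subst1_const1[OF R that] h by (simp add: c_def)
  have sA: "subst1 R s a = a \<oplus>\<^bsub>UP R\<^esub> c" if "a \<in> carrier (UP R)" for a
    using that R c by (simp add: s_def ring_hom_add[OF subst1_hom[OF R that]] subst1_var1 cA)
  have "subst1 R (subst1 R W s) k = var1 R"
    using R W h c kst Wh by (simp add: subst1_subst1 sA) (simp add: k_def cancel)
  hence "subst1 R k (subst1 R W s) = var1 R"
    using subst1_left_inverse_aux[OF R] R W kst h c by (simp add: k_def c_def coeff_const1 R.minus_eq R.r_neg)
  hence "subst1 R h (subst1 R W s) \<ominus>\<^bsub>UP R\<^esub> c = var1 R"
    using R W kst c h ring_hom_minus[where h = "\<lambda>P. subst1 R P (subst1 R W s)", OF cring_UP[OF R] cring_UP[OF R] subst1_hom]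
    by (simp add: k_def cA)
  hence "subst1 R h (subst1 R W s) = s"
    using cancel[of "subst1 R h (subst1 R W s)"] R W kst c h by (simp add: s_def)
  \<comment> \<open>The translation is undone on the right: since \<open>s(t) = y\<close>, the left
    side is \<open>h(W)\<close>.\<close>
  hence "subst1 R (subst1 R h (subst1 R W s)) t = subst1 R s t" by simp
  moreover have "subst1 R s t = var1 R" using kst R by (simp add: sA t_def cancel)
  ultimately show ?thesis using R W h kst by (simp add: subst1_subst1 subst1_var1_right)
qed

text \<open>Surjectivity of an automorphism sending \<open>y\<close> to \<open>P\<close> gives
  \<open>h(P) = y\<close>; \<open>subst1_left_inverse\<close> exchanges the sides. The side
  \<open>P(h) = y\<close> is chosen because it is what setting \<open>x = 0\<close> in an identity
  \<open>P(H) = y\<close> provides.\<close>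

lemma VA1_iff:
  assumes R: "cring R"
  shows "P \<in> VA1 R \<longleftrightarrow> P \<in> carrier (UP R) \<and> (\<exists>h \<in> carrier (UP R). subst1 R P h = var1 R)"
proof
  assume "P \<in> VA1 R"
  then obtain \<sigma> where \<sigma>: "\<sigma> \<in> ring_hom (UP R) (UP R)" "bij_betw \<sigma> (carrier (UP R)) (carrier (UP R))"
    "\<And>a. a \<in> carrier R \<Longrightarrow> \<sigma> (const1 R a) = const1 R a" "\<sigma> (var1 R) = P"
    and P: "P \<in> carrier (UP R)"
    by (auto simp: VA1_def GA1_def ring_iso_def)
  have "var1 R \<in> \<sigma> ` carrier (UP R)"
    using bij_betw_imp_surj_on[OF \<sigma>(2)] var1_closed[OF R] by simp
  then obtain h where h: "h \<in> carrier (UP R)" "\<sigma> h = var1 R" by auto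
  have "\<sigma> h = subst1 R h P"
    by (rule UP_hom_eqI[where f = \<sigma> and g = "\<lambda>Q. subst1 R Q P", OF R cring_UP[OF R] \<sigma>(1) subst1_hom[OF R P] _ _ h(1)])
      (use R P \<sigma> in \<open>simp_all add: subst1_const1 subst1_var1\<close>)
  hence "subst1 R P h = var1 R" using subst1_left_inverse[OF R h(1) P] h by simp
  thus "P \<in> carrier (UP R) \<and> (\<exists>h \<in> carrier (UP R). subst1 R P h = var1 R)" using P h by blast
next
  assume "P \<in> carrier (UP R) \<and> (\<exists>h \<in> carrier (UP R). subst1 R P h = var1 R)"
  then obtain h where P: "P \<in> carrier (UP R)" and h: "h \<in> carrier (UP R)"
    and Ph: "subst1 R P h = var1 R" by blast
  have hP: "subst1 R h P = var1 R" by (rule subst1_left_inverse[OF R P h Ph])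
  have "bij_betw (\<lambda>Q. subst1 R Q P) (carrier (UP R)) (carrier (UP R))"
    by (rule bij_betw_byWitness[where f' = "\<lambda>Q. subst1 R Q h"])
      (use R P h in \<open>auto simp: subst1_subst1 Ph hP subst1_var1_right\<close>)
  hence "(\<lambda>Q. subst1 R Q P) \<in> GA1 R"
    using subst1_hom[OF R P] subst1_const1[OF R P] by (simp add: GA1_def ring_iso_def)
  thus "P \<in> VA1 R" using P subst1_var1[OF R P] by (auto simp: VA1_def)
qed

section \<open>Endomorphisms of \<open>R[x,y]\<close> as simultaneous substitutions\<close>

definition subst_xy ::
  "('a, 'm) ring_scheme \<Rightarrow> (nat \<Rightarrow> nat \<Rightarrow> 'a) \<Rightarrow> (nat \<Rightarrow> nat \<Rightarrow> 'a) \<Rightarrow> (nat \<Rightarrow> nat \<Rightarrow> 'a) \<Rightarrow> nat \<Rightarrow> nat \<Rightarrow> 'a"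
  where "subst_xy R P A B = eval2 R (poly2 R) (const2 R) A B P"

lemma
  assumes "cring R" "A \<in> carrier (poly2 R)" "B \<in> carrier (poly2 R)"
  shows subst_xy_hom: "(\<lambda>P. subst_xy R P A B) \<in> ring_hom (poly2 R) (poly2 R)"
    and subst_xy_closed [simp]: "P \<in> carrier (poly2 R) \<Longrightarrow> subst_xy R P A B \<in> carrier (poly2 R)"
    and subst_xy_const2: "a \<in> carrier R \<Longrightarrow> subst_xy R (const2 R a) A B = const2 R a"
    and subst_xy_incl_y: "Q \<in> carrier (UP R) \<Longrightarrow> subst_xy R (incl_y R Q) A B = subst2 R Q B"
    and subst_xy_var_x: "subst_xy R (var_x R) A B = A"
    and subst_xy_var_y: "subst_xy R (var_y R) A B = B"
proof -
  note h = assms(1) cring_UP[OF cring_UP[OF assms(1)]] const2_hom[OF assms(1)] assms(2,3)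
  show s: "(\<lambda>P. subst_xy R P A B) \<in> ring_hom (poly2 R) (poly2 R)"
    using eval2_hom[OF h] by (simp add: subst_xy_def[abs_def])
  show "P \<in> carrier (poly2 R) \<Longrightarrow> subst_xy R P A B \<in> carrier (poly2 R)"
    using ring_hom_closed[OF s] by simp
  show "a \<in> carrier R \<Longrightarrow> subst_xy R (const2 R a) A B = const2 R a"
    unfolding subst_xy_def by (rule eval2_const2[OF h])
  show "Q \<in> carrier (UP R) \<Longrightarrow> subst_xy R (incl_y R Q) A B = subst2 R Q B"
    unfolding subst_xy_def subst2_def by (rule eval2_incl_y[OF h])
  show "subst_xy R (var_x R) A B = A"
    unfolding subst_xy_def by (rule eval2_var_x[OF h])
  show "subst_xy R (var_y R) A B = B"
    unfolding subst_xy_def by (rule eval2_var_y[OF h])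
qed

lemma hom_subst_xy:
  assumes "cring R" "\<sigma> \<in> ring_hom (poly2 R) (poly2 R)"
    and "\<And>a. a \<in> carrier R \<Longrightarrow> \<sigma> (const2 R a) = const2 R a" "P \<in> carrier (poly2 R)"
  shows "\<sigma> P = subst_xy R P (\<sigma> (var_x R)) (\<sigma> (var_y R))"
proof -
  have c: "\<sigma> (var_x R) \<in> carrier (poly2 R)" "\<sigma> (var_y R) \<in> carrier (poly2 R)"
    using ring_hom_closed[OF assms(2)] assms(1) by simp_all
  show ?thesis
    by (rule poly2_hom_eqI[OF assms(1) cring_UP[OF cring_UP[OF assms(1)]] assms(2)
        subst_xy_hom[OF assms(1) c] _ _ _ assms(4)])
      (use c assms(1,3) in \<open>simp_all add: subst_xy_const2 subst_xy_var_x subst_xy_var_y\<close>)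
qed

lemma subst_xy_var_x_var_y:
  assumes "cring R" "P \<in> carrier (poly2 R)"
  shows "subst_xy R P (var_x R) (var_y R) = P"
  using hom_subst_xy[OF assms(1) id_ring_hom[of "poly2 R"] _ assms(2)] by simp

lemma subst_xy_subst_xy:
  assumes "cring R" "P \<in> carrier (poly2 R)" "A \<in> carrier (poly2 R)" "B \<in> carrier (poly2 R)"
    "A' \<in> carrier (poly2 R)" "B' \<in> carrier (poly2 R)"
  shows "subst_xy R (subst_xy R P A B) A' B' = subst_xy R P (subst_xy R A A' B') (subst_xy R B A' B')"
  using hom_eval2[where h = "\<lambda>P. subst_xy R P A' B'" and c' = "const2 R", OF assms(1)
      cring_UP[OF cring_UP[OF assms(1)]] cring_UP[OF cring_UP[OF assms(1)]] const2_hom[OF assms(1)]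
      assms(3,4) subst_xy_hom[OF assms(1,5,6)] const2_hom[OF assms(1)]
      subst_xy_const2[OF assms(1,5,6)] assms(2)]
  unfolding subst_xy_def .

lemma subst_xy_subst2:
  assumes "cring R" "P \<in> carrier (UP R)" "A \<in> carrier (poly2 R)"
    "A' \<in> carrier (poly2 R)" "B' \<in> carrier (poly2 R)"
  shows "subst_xy R (subst2 R P A) A' B' = subst2 R P (subst_xy R A A' B')"
  using hom_subst2[where h = "\<lambda>P. subst_xy R P A' B'" and c = "const2 R", OF assms(1)
      cring_UP[OF cring_UP[OF assms(1)]] subst_xy_hom[OF assms(1,4,5)] const2_hom[OF assms(1)]
      subst_xy_const2[OF assms(1,4,5)] assms(2,3)]
  unfolding subst2_def .

text \<open>In contrast to the one-variable criterion, both composites of \<open>(G, F)\<close> and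
  \<open>(X, Y)\<close> are recorded, so no cancellation property for composition in two variables
  has to be established.\<close>

lemma VA2_iff:
  assumes R: "cring R"
  shows "F \<in> VA2 R \<longleftrightarrow> F \<in> carrier (poly2 R) \<and>
    (\<exists>G \<in> carrier (poly2 R). \<exists>X \<in> carrier (poly2 R). \<exists>Y \<in> carrier (poly2 R).
      subst_xy R X G F = var_x R \<and> subst_xy R Y G F = var_y R \<and>
      subst_xy R G X Y = var_x R \<and> subst_xy R F X Y = var_y R)" (is "_ \<longleftrightarrow> ?rhs")
proof
  assume "F \<in> VA2 R"
  then obtain \<sigma> where \<sigma>: "\<sigma> \<in> ring_hom (poly2 R) (poly2 R)"
    "bij_betw \<sigma> (carrier (poly2 R)) (carrier (poly2 R))"
    "\<And>a. a \<in> carrier R \<Longrightarrow> \<sigma> (const2 R a) = const2 R a" "\<sigma> (var_y R) = F"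
    and F: "F \<in> carrier (poly2 R)"
    by (auto simp: VA2_def GA2_def ring_iso_def)
  define G where "G = \<sigma> (var_x R)"
  have G: "G \<in> carrier (poly2 R)" using ring_hom_closed[OF \<sigma>(1)] R by (simp add: G_def)
  have sub: "\<sigma> P = subst_xy R P G F" if "P \<in> carrier (poly2 R)" for P
    unfolding G_def \<sigma>(4)[symmetric] by (rule hom_subst_xy[where \<sigma> = \<sigma>, OF R \<sigma>(1,3) that])
  have "var_x R \<in> \<sigma> ` carrier (poly2 R)" "var_y R \<in> \<sigma> ` carrier (poly2 R)"
    using bij_betw_imp_surj_on[OF \<sigma>(2)] poly2_closed(1,2)[OF R] by simp_all
  then obtain X Y where X: "X \<in> carrier (poly2 R)" "\<sigma> X = var_x R"
    and Y: "Y \<in> carrier (poly2 R)" "\<sigma> Y = var_y R" by auto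
  have e: "subst_xy R X G F = var_x R" "subst_xy R Y G F = var_y R"
    using sub X Y by simp_all
  have inj: "inj_on \<sigma> (carrier (poly2 R))" using \<sigma>(2) by (rule bij_betw_imp_inj_on)
  \<comment> \<open>Applying \<open>\<sigma>\<close> amounts to substituting \<open>(G, F)\<close>,
    which undoes \<open>(X, Y)\<close>; injectivity of \<open>\<sigma>\<close> then removes it
    again.\<close>
  have inv: "subst_xy R (\<sigma> P) X Y = P" if P: "P \<in> carrier (poly2 R)" for P
  proof (rule inj_onD[OF inj])
    have \<sigma>P: "\<sigma> P \<in> carrier (poly2 R)" using ring_hom_closed[OF \<sigma>(1) P] .
    show "\<sigma> (subst_xy R (\<sigma> P) X Y) = \<sigma> P"
      using R \<sigma>P X(1) Y(1) F G
      by (simp add: sub[of "subst_xy R (\<sigma> P) X Y"] subst_xy_subst_xy e subst_xy_var_x_var_y)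
    show "subst_xy R (\<sigma> P) X Y \<in> carrier (poly2 R)" using \<sigma>P R X(1) Y(1) by simp
  qed (fact P)
  have "subst_xy R G X Y = var_x R" "subst_xy R F X Y = var_y R"
    using inv[of "var_x R"] inv[of "var_y R"] R \<sigma>(4) G_def by simp_all
  thus ?rhs using F G X(1) Y(1) e by blast
next
  assume ?rhs
  then obtain G X Y where c: "F \<in> carrier (poly2 R)" "G \<in> carrier (poly2 R)"
    "X \<in> carrier (poly2 R)" "Y \<in> carrier (poly2 R)"
    and e: "subst_xy R X G F = var_x R" "subst_xy R Y G F = var_y R"
      "subst_xy R G X Y = var_x R" "subst_xy R F X Y = var_y R" by blast
  have "bij_betw (\<lambda>P. subst_xy R P G F) (carrier (poly2 R)) (carrier (poly2 R))"
    by (rule bij_betw_byWitness[where f' = "\<lambda>P. subst_xy R P X Y"])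
      (use R c in \<open>auto simp: subst_xy_subst_xy e subst_xy_var_x_var_y\<close>)
  hence "(\<lambda>P. subst_xy R P G F) \<in> GA2 R"
    using subst_xy_hom[OF R c(2,1)] subst_xy_const2[OF R c(2,1)] by (simp add: GA2_def ring_iso_def)
  thus "F \<in> VA2 R" using c subst_xy_var_y[OF R c(2,1)] by (auto simp: VA2_def)
qed

section \<open>Reduction modulo an element\<close>

lemma
  assumes R: "cring R" and p: "p \<in> carrier R"
  shows cring_quot: "cring (quot R p)"
    and phi_hom: "phi R p \<in> ring_hom R (quot R p)"
    and phi_surj: "A \<in> carrier (quot R p) \<Longrightarrow> \<exists>a \<in> carrier R. phi R p a = A"
    and phi_eq_zeroD: "a \<in> carrier R \<Longrightarrow> phi R p a = \<zero>\<^bsub>quot R p\<^esub> \<Longrightarrow> \<exists>b \<in> carrier R. a = p \<otimes>\<^bsub>R\<^esub> b"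
    and phi_self: "phi R p p = \<zero>\<^bsub>quot R p\<^esub>"
proof -
  interpret cring R by (rule R)
  interpret I: ideal "PIdl\<^bsub>R\<^esub> p" R by (rule cgenideal_ideal[OF p])
  show "cring (quot R p)" unfolding quot_def by (rule I.quotient_is_cring[OF R])
  show "phi R p \<in> ring_hom R (quot R p)"
    using I.rcos_ring_hom by (simp add: quot_def phi_def[abs_def])
  show "A \<in> carrier (quot R p) \<Longrightarrow> \<exists>a \<in> carrier R. phi R p a = A"
    by (auto simp: quot_def phi_def FactRing_def A_RCOSETS_def')
  show "\<exists>b \<in> carrier R. a = p \<otimes>\<^bsub>R\<^esub> b" if a: "a \<in> carrier R" "phi R p a = \<zero>\<^bsub>quot R p\<^esub>"
  proof -
    have "PIdl\<^bsub>R\<^esub> p +>\<^bsub>R\<^esub> a = PIdl\<^bsub>R\<^esub> p" using a(2) by (simp add: phi_def quot_def FactRing_def)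
    hence "a \<in> PIdl\<^bsub>R\<^esub> p" using I.a_rcos_self[OF a(1)] by simp
    then obtain b where "b \<in> carrier R" "a = b \<otimes>\<^bsub>R\<^esub> p" unfolding cgenideal_def by blast
    thus ?thesis using m_comm[OF _ p] by blast
  qed
  show "phi R p p = \<zero>\<^bsub>quot R p\<^esub>"
    using I.a_rcos_const[OF cgenideal_self[OF p]] by (simp add: phi_def quot_def FactRing_def)
qed

text \<open>Choosing coefficients one by one does not ensure finite support. Beyond \<open>N\<close>
  the coefficient is set to zero, which is why \<open>S\<close> must accept zero there. Both
  division by a constant and lifting from a quotient use this.\<close>

lemma UP_choose:
  assumes R: "cring R" and ex: "\<And>n. \<exists>b \<in> carrier R. S n b" and z: "\<And>n. N < n \<Longrightarrow> S n \<zero>\<^bsub>R\<^esub>"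
  shows "\<exists>Q \<in> carrier (UP R). \<forall>n. S n (coeff (UP R) Q n)"
proof -
  interpret UP_cring R "UP R" by (rule UP_cringI[OF R])
  obtain f where f: "\<And>n. f n \<in> carrier R" "\<And>n. S n (f n)" using ex by metis
  define Q where "Q = (\<lambda>n. if N < n then \<zero>\<^bsub>R\<^esub> else f n)"
  have Q: "Q \<in> up R"
  proof (rule mem_upI)
    show "Q n \<in> carrier R" for n using f(1) by (simp add: Q_def)
    have "bound \<zero>\<^bsub>R\<^esub> N Q" by (rule bound.intro) (simp add: Q_def)
    thus "\<exists>n. bound \<zero>\<^bsub>R\<^esub> n Q" by blast
  qed
  have "S n (Q n)" for n by (cases "N < n") (simp_all add: Q_def f(2) z)
  hence "S n (coeff (UP R) Q n)" for n using Q by (simp add: UP_def)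
  moreover have "Q \<in> carrier (UP R)" using Q by (simp add: UP_def)
  ultimately show ?thesis by blast
qed

lemma coeff_const1_mult:
  assumes "cring R" "a \<in> carrier R" "P \<in> carrier (UP R)"
  shows "coeff (UP R) (const1 R a \<otimes>\<^bsub>UP R\<^esub> P) n = a \<otimes>\<^bsub>R\<^esub> coeff (UP R) P n"
proof -
  interpret UP_cring R "UP R" by (rule UP_cringI[OF assms(1)])
  show ?thesis using assms by (simp add: const1_def monom_mult_is_smult)
qed

text \<open>The base ring is kept arbitrary so that \<open>R[y]\<close> can take its place: division
  of elements of \<open>R[x,y]\<close> by constants is that instance.\<close>

lemma const1_dvd:
  assumes R: "cring R" and p: "p \<in> carrier R" and P: "P \<in> carrier (UP R)"
    and dvd: "\<And>n. \<exists>b \<in> carrier R. coeff (UP R) P n = p \<otimes>\<^bsub>R\<^esub> b"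
  shows "\<exists>Q \<in> carrier (UP R). P = const1 R p \<otimes>\<^bsub>UP R\<^esub> Q"
proof -
  interpret UP_cring R "UP R" by (rule UP_cringI[OF R])
  have z: "coeff (UP R) P n = p \<otimes>\<^bsub>R\<^esub> \<zero>\<^bsub>R\<^esub>" if "deg R P < n" for n
    using deg_aboveD[OF that P] p by simp
  obtain Q where Q: "Q \<in> carrier (UP R)" "\<And>n. coeff (UP R) P n = p \<otimes>\<^bsub>R\<^esub> coeff (UP R) Q n"
    using UP_choose[where S = "\<lambda>n b. coeff (UP R) P n = p \<otimes>\<^bsub>R\<^esub> b", OF R dvd z] by blast
  have "P = const1 R p \<otimes>\<^bsub>UP R\<^esub> Q"
    by (rule up_eqI) (use P Q R p in \<open>simp_all add: coeff_const1_mult del: coeff_mult\<close>)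
  thus ?thesis using Q(1) by blast
qed

lemma const1_non_zero_divisor:
  assumes R: "cring R" and d: "d \<in> non_zero_divisors R"
  shows "const1 R d \<in> non_zero_divisors (UP R)"
proof -
  interpret UP_cring R "UP R" by (rule UP_cringI[OF R])
  have dR: "d \<in> carrier R" and nz: "\<And>b. b \<in> carrier R \<Longrightarrow> d \<otimes>\<^bsub>R\<^esub> b = \<zero>\<^bsub>R\<^esub> \<Longrightarrow> b = \<zero>\<^bsub>R\<^esub>"
    using d unfolding non_zero_divisors_def by blast+
  have "P = \<zero>\<^bsub>UP R\<^esub>" if P: "P \<in> carrier (UP R)" "const1 R d \<otimes>\<^bsub>UP R\<^esub> P = \<zero>\<^bsub>UP R\<^esub>" for P
  proof (rule up_eqI[OF _ P(1) UP_zero_closed])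
    fix n
    have "d \<otimes>\<^bsub>R\<^esub> coeff (UP R) P n = \<zero>\<^bsub>R\<^esub>"
      using coeff_const1_mult[OF R dR P(1), of n] P(2) by simp
    thus "coeff (UP R) P n = coeff (UP R) \<zero>\<^bsub>UP R\<^esub> n" using nz[OF coeff_closed[OF P(1)]] by simp
  qed
  thus ?thesis unfolding non_zero_divisors_def using const1_closed[OF R dR] by blast
qed

lemma const2_non_zero_divisor:
  "cring R \<Longrightarrow> d \<in> non_zero_divisors R \<Longrightarrow> const2 R d \<in> non_zero_divisors (poly2 R)"
  unfolding const2_eq by (intro const1_non_zero_divisor cring_UP)

lemma (in ring) non_zero_divisor_cancel:
  assumes "d \<in> non_zero_divisors R" "a \<in> carrier R" "a' \<in> carrier R"
    and "d \<otimes> a = d \<otimes> a'"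
  shows "a = a'"
proof -
  have d: "d \<in> carrier R" using assms(1) by (simp add: non_zero_divisors_def)
  from assms(4) have "d \<otimes> (a \<ominus> a') = \<zero>" using d assms(2,3) by (simp add: a_minus_def r_distr r_minus r_neg)
  hence "a \<ominus> a' = \<zero>" using assms(1-3) by (simp add: non_zero_divisors_def)
  thus ?thesis using assms(2,3) by (rule minus_eq_zeroD)
qed

text \<open>Applied to \<open>phi\<close> this describes \<open>phi1\<close>, and applied to
  \<open>phi1\<close> over \<open>R[y]\<close> it describes \<open>phi2\<close>. The last clause is
  stated because \<open>coeff\<close> is a restricted function, which can be evaluated only after
  membership in \<open>up S\<close> is known.\<close>

lemma coeffwise_hom:
  assumes R: "cring R" and S: "cring S" and h: "h \<in> ring_hom R S"
  shows "(\<lambda>P n. h (coeff (UP R) P n)) \<in> ring_hom (UP R) (UP S)"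
    and "a \<in> carrier R \<Longrightarrow> (\<lambda>n. h (coeff (UP R) (const1 R a) n)) = const1 S (h a)"
    and "(\<lambda>n. h (coeff (UP R) (var1 R) n)) = var1 S"
    and "P \<in> carrier (UP R) \<Longrightarrow> coeff (UP S) (\<lambda>n. h (coeff (UP R) P n)) = (\<lambda>n. h (coeff (UP R) P n))"
proof -
  interpret UP_cring R "UP R" by (rule UP_cringI[OF R])
  interpret S: UP_cring S "UP S" by (rule UP_cringI[OF S])
  interpret h: ring_hom_cring R S h
    using R S h by (auto intro: ring_hom_cring.intro ring_hom_cring_axioms.intro)
  have up: "(\<lambda>n. h (coeff (UP R) P n)) \<in> up S" if P: "P \<in> carrier (UP R)" for P
  proof (rule mem_upI)
    show "h (coeff (UP R) P n) \<in> carrier S" for n using P by simp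
    have "bound \<zero>\<^bsub>S\<^esub> (deg R P) (\<lambda>n. h (coeff (UP R) P n))"
      by (rule bound.intro) (simp add: deg_aboveD[OF _ P])
    thus "\<exists>n. bound \<zero>\<^bsub>S\<^esub> n (\<lambda>n. h (coeff (UP R) P n))" by blast
  qed
  have cl: "(\<lambda>n. h (coeff (UP R) P n)) \<in> carrier (UP S)" if P: "P \<in> carrier (UP R)" for P
    using up[OF P] by (simp add: UP_def)
  show co: "coeff (UP S) (\<lambda>n. h (coeff (UP R) P n)) = (\<lambda>n. h (coeff (UP R) P n))"
    if P: "P \<in> carrier (UP R)" for P
    using up[OF P] by (simp add: UP_def restrict_def)
  have eq: "(\<lambda>n. h (coeff (UP R) P n)) = Q"
    if "P \<in> carrier (UP R)" "Q \<in> carrier (UP S)" "\<And>n. h (coeff (UP R) P n) = coeff (UP S) Q n" for P Q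
    by (rule S.up_eqI[OF _ cl[OF that(1)] that(2)]) (unfold co[OF that(1)], rule that(3))
  show "(\<lambda>n. h (coeff (UP R) (const1 R a) n)) = const1 S (h a)" if "a \<in> carrier R"
    using that R S by (rule_tac eq) (auto simp: coeff_const1)
  show "(\<lambda>n. h (coeff (UP R) (var1 R) n)) = var1 S"
    using R S by (rule_tac eq) (auto simp: var1_def)
  show "(\<lambda>P n. h (coeff (UP R) P n)) \<in> ring_hom (UP R) (UP S)"
  proof (rule ring_hom_memI)
    fix P Q assume P: "P \<in> carrier (UP R)" and Q: "Q \<in> carrier (UP R)"
    show "(\<lambda>n. h (coeff (UP R) (P \<otimes>\<^bsub>UP R\<^esub> Q) n)) =
        (\<lambda>n. h (coeff (UP R) P n)) \<otimes>\<^bsub>UP S\<^esub> (\<lambda>n. h (coeff (UP R) Q n))"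
      using P Q cl by (rule_tac eq) (auto simp: co Pi_def comp_def intro!: S.R.finsum_cong')
    show "(\<lambda>n. h (coeff (UP R) (P \<oplus>\<^bsub>UP R\<^esub> Q) n)) =
        (\<lambda>n. h (coeff (UP R) P n)) \<oplus>\<^bsub>UP S\<^esub> (\<lambda>n. h (coeff (UP R) Q n))"
      using P Q cl by (rule_tac eq) (auto simp: co)
  next
    show "(\<lambda>n. h (coeff (UP R) \<one>\<^bsub>UP R\<^esub> n)) = \<one>\<^bsub>UP S\<^esub>"
      by (rule eq) auto
  qed (rule cl)
qed

lemma
  assumes R: "cring R" and p: "p \<in> carrier R"
  shows phi1_hom: "phi1 R p \<in> ring_hom (UP R) (UP (quot R p))"
    and phi1_const1: "a \<in> carrier R \<Longrightarrow> phi1 R p (const1 R a) = const1 (quot R p) (phi R p a)"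
    and phi1_var1: "phi1 R p (var1 R) = var1 (quot R p)"
    and coeff_phi1: "P \<in> carrier (UP R) \<Longrightarrow> coeff (UP (quot R p)) (phi1 R p P) n = phi R p (coeff (UP R) P n)"
  using coeffwise_hom[OF R cring_quot[OF R p] phi_hom[OF R p]]
  by (simp_all add: phi1_def[abs_def])

lemma
  assumes R: "cring R" and p: "p \<in> carrier R"
  shows phi2_hom: "phi2 R p \<in> ring_hom (poly2 R) (poly2 (quot R p))"
    and phi2_incl_y: "P \<in> carrier (UP R) \<Longrightarrow> phi2 R p (incl_y R P) = incl_y (quot R p) (phi1 R p P)"
    and phi2_const2: "a \<in> carrier R \<Longrightarrow> phi2 R p (const2 R a) = const2 (quot R p) (phi R p a)"
    and phi2_var_x: "phi2 R p (var_x R) = var_x (quot R p)"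
    and phi2_var_y: "phi2 R p (var_y R) = var_y (quot R p)"
    and coeff_phi2: "F \<in> carrier (poly2 R) \<Longrightarrow>
      coeff (poly2 (quot R p)) (phi2 R p F) n = phi1 R p (coeff (poly2 R) F n)"
  using coeffwise_hom[OF cring_UP[OF R] cring_UP[OF cring_quot[OF R p]] phi1_hom[OF R p]]
  by (simp_all add: phi2_def[abs_def] incl_y_eq const2_eq var_x_eq var_y_eq
      phi1_const1[OF R p] phi1_var1[OF R p] R)

lemma phi1_surj:
  assumes R: "cring R" and p: "p \<in> carrier R" and Q: "Q \<in> carrier (UP (quot R p))"
  shows "\<exists>P \<in> carrier (UP R). phi1 R p P = Q"
proof -
  interpret UP_cring R "UP R" by (rule UP_cringI[OF R])
  interpret A: UP_cring "quot R p" "UP (quot R p)" by (rule UP_cringI[OF cring_quot[OF R p]])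
  have z: "phi R p \<zero>\<^bsub>R\<^esub> = coeff (UP (quot R p)) Q n" if "deg (quot R p) Q < n" for n
    using A.deg_aboveD[OF that Q] ring_hom_zero[OF phi_hom[OF R p] R.ring_axioms A.R.ring_axioms] by simp
  obtain P where P: "P \<in> carrier (UP R)" "\<And>n. phi R p (coeff (UP R) P n) = coeff (UP (quot R p)) Q n"
    using UP_choose[where S = "\<lambda>n b. phi R p b = coeff (UP (quot R p)) Q n",
      OF R phi_surj[OF R p A.coeff_closed[OF Q]] z] by blast
  have "phi1 R p P = Q"
    by (rule A.up_eqI[OF _ _ Q])
      (use P Q R p ring_hom_closed[OF phi1_hom[OF R p]] in \<open>simp_all add: coeff_phi1\<close>)
  thus ?thesis using P(1) by blast
qed

lemma phi1_eq_zeroD: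
  assumes R: "cring R" and p: "p \<in> carrier R" and P: "P \<in> carrier (UP R)"
    and z: "phi1 R p P = \<zero>\<^bsub>UP (quot R p)\<^esub>"
  shows "\<exists>Q \<in> carrier (UP R). P = const1 R p \<otimes>\<^bsub>UP R\<^esub> Q"
proof (rule const1_dvd[OF R p P])
  fix n
  interpret UP_cring R "UP R" by (rule UP_cringI[OF R])
  interpret A: UP_cring "quot R p" "UP (quot R p)" by (rule UP_cringI[OF cring_quot[OF R p]])
  show "\<exists>b \<in> carrier R. coeff (UP R) P n = p \<otimes>\<^bsub>R\<^esub> b"
    using coeff_phi1[OF R p P, of n] z by (intro phi_eq_zeroD[OF R p coeff_closed[OF P]]) simp
qed

lemma phi2_eq_zeroD:
  assumes R: "cring R" and p: "p \<in> carrier R" and F: "F \<in> carrier (poly2 R)"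
    and z: "phi2 R p F = \<zero>\<^bsub>poly2 (quot R p)\<^esub>"
  shows "\<exists>Q \<in> carrier (poly2 R). F = const2 R p \<otimes>\<^bsub>poly2 R\<^esub> Q"
  unfolding const2_eq
proof (rule const1_dvd[OF cring_UP[OF R] const1_closed[OF R p] F])
  fix n
  interpret UP_cring "UP R" "poly2 R" by (rule UP_cringI[OF cring_UP[OF R]])
  interpret A: UP_cring "UP (quot R p)" "poly2 (quot R p)"
    by (rule UP_cringI[OF cring_UP[OF cring_quot[OF R p]]])
  show "\<exists>b \<in> carrier (UP R). coeff (poly2 R) F n = const1 R p \<otimes>\<^bsub>UP R\<^esub> b"
    using coeff_phi2[OF R p F, of n] z by (intro phi1_eq_zeroD[OF R p coeff_closed[OF F]]) simp
qed

text \<open>The congruence is delivered as a sum instead of a divisible difference, since it is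
  later pushed through \<open>subst_xy\<close> by \<open>subst_xy_add\<close> and
  \<open>subst_xy_mult\<close>. The quotients completing the automorphisms below come from
  here.\<close>

lemma phi2_eqD:
  assumes R: "cring R" and p: "p \<in> carrier R" and F: "F \<in> carrier (poly2 R)" and G: "G \<in> carrier (poly2 R)"
    and e: "phi2 R p F = phi2 R p G"
  obtains Q where "Q \<in> carrier (poly2 R)" "F = const2 R p \<otimes>\<^bsub>poly2 R\<^esub> Q \<oplus>\<^bsub>poly2 R\<^esub> G"
proof -
  interpret S: cring "poly2 R" by (intro cring_UP R)
  interpret A: cring "poly2 (quot R p)" by (intro cring_UP cring_quot R p)
  have "phi2 R p (F \<ominus>\<^bsub>poly2 R\<^esub> G) = phi2 R p F \<ominus>\<^bsub>poly2 (quot R p)\<^esub> phi2 R p G"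
    by (rule ring_hom_minus[OF S.cring_axioms A.cring_axioms phi2_hom[OF R p] F G])
  also have "\<dots> = \<zero>\<^bsub>poly2 (quot R p)\<^esub>"
    using ring_hom_closed[OF phi2_hom[OF R p] G] by (simp add: e a_minus_def A.r_neg)
  finally obtain Q where Q: "Q \<in> carrier (poly2 R)" "F \<ominus>\<^bsub>poly2 R\<^esub> G = const2 R p \<otimes>\<^bsub>poly2 R\<^esub> Q"
    using phi2_eq_zeroD[OF R p S.minus_closed[OF F G]] by blast
  have "F = (F \<ominus>\<^bsub>poly2 R\<^esub> G) \<oplus>\<^bsub>poly2 R\<^esub> G" using F G by (simp add: a_minus_def S.a_assoc S.l_neg)
  with Q that show ?thesis by simp
qed

lemma phi1_subst1:
  assumes R: "cring R" and p: "p \<in> carrier R" and P: "P \<in> carrier (UP R)" and A: "A \<in> carrier (UP R)"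
  shows "phi1 R p (subst1 R P A) = subst1 (quot R p) (phi1 R p P) (phi1 R p A)"
proof -
  have c: "phi1 R p A \<in> carrier (UP (quot R p))" by (rule ring_hom_closed[OF phi1_hom[OF R p] A])
  have "(phi1 R p \<circ> (\<lambda>P. subst1 R P A)) P = ((\<lambda>Q. subst1 (quot R p) Q (phi1 R p A)) \<circ> phi1 R p) P"
    by (rule UP_hom_eqI[OF R cring_UP[OF cring_quot[OF R p]]
        ring_hom_trans[OF subst1_hom[OF R A] phi1_hom[OF R p]]
        ring_hom_trans[OF phi1_hom[OF R p] subst1_hom[OF cring_quot[OF R p] c]] _ _ P])
      (use R p A c cring_quot[OF R p] ring_hom_closed[OF phi_hom[OF R p]] in
        \<open>simp_all add: subst1_const1 phi1_const1 subst1_var1 phi1_var1\<close>)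
  thus ?thesis by simp
qed

lemma phi2_subst2:
  assumes R: "cring R" and p: "p \<in> carrier R" and P: "P \<in> carrier (UP R)" and A: "A \<in> carrier (poly2 R)"
  shows "phi2 R p (subst2 R P A) = subst2 (quot R p) (phi1 R p P) (phi2 R p A)"
proof -
  have c: "phi2 R p A \<in> carrier (poly2 (quot R p))" by (rule ring_hom_closed[OF phi2_hom[OF R p] A])
  have "(phi2 R p \<circ> (\<lambda>P. subst2 R P A)) P = ((\<lambda>Q. subst2 (quot R p) Q (phi2 R p A)) \<circ> phi1 R p) P"
    by (rule UP_hom_eqI[OF R cring_UP[OF cring_UP[OF cring_quot[OF R p]]]
        ring_hom_trans[OF subst2_hom[OF R A] phi2_hom[OF R p]]
        ring_hom_trans[OF phi1_hom[OF R p] subst2_hom[OF cring_quot[OF R p] c]] _ _ P])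
      (use R p A c cring_quot[OF R p] ring_hom_closed[OF phi_hom[OF R p]] in
        \<open>simp_all add: subst2_const1 phi1_const1 phi2_const2 subst2_var1 phi1_var1\<close>)
  thus ?thesis by simp
qed

lemma phi2_subst_xy:
  assumes R: "cring R" and p: "p \<in> carrier R" and P: "P \<in> carrier (poly2 R)"
    and A: "A \<in> carrier (poly2 R)" and B: "B \<in> carrier (poly2 R)"
  shows "phi2 R p (subst_xy R P A B) = subst_xy (quot R p) (phi2 R p P) (phi2 R p A) (phi2 R p B)"
proof -
  have c: "phi2 R p A \<in> carrier (poly2 (quot R p))" "phi2 R p B \<in> carrier (poly2 (quot R p))"
    by (rule ring_hom_closed[OF phi2_hom[OF R p]], fact)+
  have "(phi2 R p \<circ> (\<lambda>P. subst_xy R P A B)) P =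
      ((\<lambda>Q. subst_xy (quot R p) Q (phi2 R p A) (phi2 R p B)) \<circ> phi2 R p) P"
    by (rule poly2_hom_eqI[OF R cring_UP[OF cring_UP[OF cring_quot[OF R p]]]
        ring_hom_trans[OF subst_xy_hom[OF R A B] phi2_hom[OF R p]]
        ring_hom_trans[OF phi2_hom[OF R p] subst_xy_hom[OF cring_quot[OF R p] c]] _ _ _ P])
      (use R p A B c cring_quot[OF R p] ring_hom_closed[OF phi_hom[OF R p]] in
        \<open>simp_all add: subst_xy_const2 phi2_const2 subst_xy_var_x subst_xy_var_y phi2_var_x phi2_var_y\<close>)
  thus ?thesis by simp
qed

section \<open>Automorphisms and scaling of a variable\<close>

text \<open>Setting \<open>x = 0\<close> and substituting \<open>h\<close> for \<open>y\<close>
  becomes a single substitution inside \<open>R[x,y]\<close>, to which the composition law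
  \<open>subst_xy_subst_xy\<close> applies.\<close>

lemma subst_xy_zero_incl_y:
  assumes R: "cring R" and P: "P \<in> carrier (poly2 R)" and h: "h \<in> carrier (UP R)"
  shows "subst_xy R P \<zero>\<^bsub>poly2 R\<^esub> (incl_y R h) = incl_y R (subst1 R (at_x0 R P) h)"
proof -
  interpret S: cring "poly2 R" by (intro cring_UP R)
  have z: "incl_y R \<zero>\<^bsub>UP R\<^esub> = \<zero>\<^bsub>poly2 R\<^esub>"
    by (rule ring_hom_zero[OF incl_y_hom[OF R] cring.axioms(1)[OF cring_UP[OF R]] S.ring_axioms])
  have z1: "subst1 R \<zero>\<^bsub>UP R\<^esub> h = \<zero>\<^bsub>UP R\<^esub>"
    by (rule ring_hom_zero[OF subst1_hom[OF R h]]) (rule cring.axioms(1)[OF cring_UP[OF R]])+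
  have i: "incl_y R h \<in> carrier (poly2 R)" using R h by simp
  have "subst_xy R P \<zero>\<^bsub>poly2 R\<^esub> (incl_y R h) = (incl_y R \<circ> ((\<lambda>Q. subst1 R Q h) \<circ> at_x0 R)) P"
    by (rule poly2_hom_eqI[OF R S.cring_axioms subst_xy_hom[OF R S.zero_closed i]
          ring_hom_trans[OF ring_hom_trans[OF at_x0_hom[OF R] subst1_hom[OF R h]] incl_y_hom[OF R]] _ _ _ P])
      (use R h i in \<open>simp_all add: subst_xy_const2 at_x0_const2 subst1_const1 const2_def[symmetric]
         subst_xy_var_x subst_xy_var_y at_x0_var_x at_x0_var_y subst1_var1 z z1\<close>)
  thus ?thesis by simp
qed

lemma at_x0_phi2:
  assumes R: "cring R" and p: "p \<in> carrier R" and P: "P \<in> carrier (poly2 R)"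
  shows "at_x0 (quot R p) (phi2 R p P) = phi1 R p (at_x0 R P)"
proof -
  have A: "cring (quot R p)" by (rule cring_quot[OF R p])
  have z: "phi1 R p \<zero>\<^bsub>UP R\<^esub> = \<zero>\<^bsub>UP (quot R p)\<^esub>"
    by (rule ring_hom_zero[OF phi1_hom[OF R p] cring.axioms(1)[OF cring_UP[OF R]] cring.axioms(1)[OF cring_UP[OF A]]])
  have "(at_x0 (quot R p) \<circ> phi2 R p) P = (phi1 R p \<circ> at_x0 R) P"
    by (rule poly2_hom_eqI[OF R cring_UP[OF A] ring_hom_trans[OF phi2_hom[OF R p] at_x0_hom[OF A]]
          ring_hom_trans[OF at_x0_hom[OF R] phi1_hom[OF R p]] _ _ _ P])
      (use R p A ring_hom_closed[OF phi_hom[OF R p]] in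
        \<open>simp_all add: phi2_const2 at_x0_const2 phi1_const1 phi2_var_x phi2_var_y at_x0_var_x
           at_x0_var_y phi1_var1 z\<close>)
  thus ?thesis by simp
qed

lemma phi2_const2_mult:
  assumes R: "cring R" and p: "p \<in> carrier R" and P: "P \<in> carrier (poly2 R)"
  shows "phi2 R p (const2 R p \<otimes>\<^bsub>poly2 R\<^esub> P) = \<zero>\<^bsub>poly2 (quot R p)\<^esub>"
proof -
  interpret A: cring "quot R p" by (rule cring_quot[OF R p])
  interpret SA: cring "poly2 (quot R p)" by (intro cring_UP cring_quot R p)
  have "const2 (quot R p) \<zero>\<^bsub>quot R p\<^esub> = \<zero>\<^bsub>poly2 (quot R p)\<^esub>"
    by (rule ring_hom_zero[OF const2_hom[OF A.cring_axioms] A.ring_axioms SA.ring_axioms])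
  thus ?thesis
    using R p P ring_hom_closed[OF phi2_hom[OF R p] P]
    by (simp add: ring_hom_mult[OF phi2_hom[OF R p]] phi2_const2 phi_self)
qed

text \<open>Modulo \<open>p\<close> the product \<open>p x\<close> vanishes, so replacing
  \<open>x\<close> by \<open>p x\<close> is the same as setting \<open>x = 0\<close>.\<close>

lemma phi2_subst_xy_const2_mult_var_x:
  assumes R: "cring R" and p: "p \<in> carrier R" and P: "P \<in> carrier (poly2 R)"
  shows "phi2 R p (subst_xy R P (const2 R p \<otimes>\<^bsub>poly2 R\<^esub> var_x R) (var_y R)) =
    incl_y (quot R p) (phi1 R p (at_x0 R P))"
proof -
  interpret S: cring "poly2 R" by (intro cring_UP R)
  have A: "cring (quot R p)" by (rule cring_quot[OF R p])
  have c: "phi2 R p P \<in> carrier (poly2 (quot R p))" by (rule ring_hom_closed[OF phi2_hom[OF R p] P])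
  have "phi2 R p (subst_xy R P (const2 R p \<otimes>\<^bsub>poly2 R\<^esub> var_x R) (var_y R)) =
    subst_xy (quot R p) (phi2 R p P) \<zero>\<^bsub>poly2 (quot R p)\<^esub> (incl_y (quot R p) (var1 (quot R p)))"
    using R p P by (simp add: phi2_subst_xy phi2_const2_mult phi2_var_y var_y_def)
      (simp add: phi2_var_y[OF R p, unfolded var_y_def])
  also have "\<dots> = incl_y (quot R p) (phi1 R p (at_x0 R P))"
    using R p P A c ring_hom_closed[OF at_x0_hom[OF A] c]
    by (simp add: subst_xy_zero_incl_y subst1_var1_right at_x0_phi2)
  finally show ?thesis .
qed

lemma at_x0_subst_xy_const2_mult_var_x:
  assumes R: "cring R" and p: "p \<in> carrier R" and P: "P \<in> carrier (poly2 R)"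
  shows "at_x0 R (subst_xy R P (const2 R p \<otimes>\<^bsub>poly2 R\<^esub> var_x R) (var_y R)) = at_x0 R P"
proof -
  interpret P: cring "UP R" by (intro cring_UP R)
  interpret S: cring "poly2 R" by (intro cring_UP R)
  have c: "const2 R p \<otimes>\<^bsub>poly2 R\<^esub> var_x R \<in> carrier (poly2 R)" "var_y R \<in> carrier (poly2 R)"
    using R p by simp_all
  have m: "at_x0 R (const2 R p \<otimes>\<^bsub>poly2 R\<^esub> var_x R) = \<zero>\<^bsub>UP R\<^esub>"
    using R p by (simp add: ring_hom_mult[OF at_x0_hom[OF R]] at_x0_const2 at_x0_var_x)
  have "(at_x0 R \<circ> (\<lambda>P. subst_xy R P (const2 R p \<otimes>\<^bsub>poly2 R\<^esub> var_x R) (var_y R))) P = at_x0 R P"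
    by (rule poly2_hom_eqI[OF R P.cring_axioms ring_hom_trans[OF subst_xy_hom[OF R c] at_x0_hom[OF R]]
          at_x0_hom[OF R] _ _ _ P])
      (use R p c in \<open>simp_all add: subst_xy_const2 subst_xy_var_x subst_xy_var_y m at_x0_var_x\<close>)
  thus ?thesis by simp
qed

lemma
  assumes "cring R" "A \<in> carrier (poly2 R)" "B \<in> carrier (poly2 R)"
    "P \<in> carrier (poly2 R)" "Q \<in> carrier (poly2 R)"
  shows subst_xy_add: "subst_xy R (P \<oplus>\<^bsub>poly2 R\<^esub> Q) A B = subst_xy R P A B \<oplus>\<^bsub>poly2 R\<^esub> subst_xy R Q A B"
    and subst_xy_mult: "subst_xy R (P \<otimes>\<^bsub>poly2 R\<^esub> Q) A B = subst_xy R P A B \<otimes>\<^bsub>poly2 R\<^esub> subst_xy R Q A B"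
  using ring_hom_add[OF subst_xy_hom[OF assms(1-3)] assms(4,5)]
    ring_hom_mult[OF subst_xy_hom[OF assms(1-3)] assms(4,5)] by simp_all

text \<open>The inverse of \<open>f\<close> exists only over the quotient, while the explicit
  constructions need a polynomial over \<open>R\<close>. Any coefficientwise lift will do, and both
  composites are kept because both are used.\<close>

lemma VA1_lift_inverse:
  assumes R: "cring R" and p: "p \<in> carrier R" and f: "f \<in> carrier (UP R)"
    and VA: "phi1 R p f \<in> VA1 (quot R p)"
  obtains h where "h \<in> carrier (UP R)"
    "subst1 (quot R p) (phi1 R p f) (phi1 R p h) = var1 (quot R p)"
    "subst1 (quot R p) (phi1 R p h) (phi1 R p f) = var1 (quot R p)"
proof -
  have A: "cring (quot R p)" by (rule cring_quot[OF R p])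
  obtain g where g: "g \<in> carrier (UP (quot R p))" "subst1 (quot R p) (phi1 R p f) g = var1 (quot R p)"
    using VA unfolding VA1_iff[OF A] by blast
  obtain h where h: "h \<in> carrier (UP R)" "phi1 R p h = g" using phi1_surj[OF R p g(1)] by blast
  have "subst1 (quot R p) g (phi1 R p f) = var1 (quot R p)"
    by (rule subst1_left_inverse[OF A ring_hom_closed[OF phi1_hom[OF R p] f] g])
  with h g(2) that show ?thesis by simp
qed

text \<open>If \<open>(N, F)\<close> has inverse \<open>(X, Y)\<close> and \<open>h\<close> inverts \<open>F(0, y)\<close> modulo \<open>q\<close>, then
  \<open>N(q x, y)\<close> agrees modulo \<open>q\<close> with \<open>B(F(q x, y))\<close>, where \<open>B(y) = N(0, h(y))\<close>; the quotient \<open>G\<close> of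
  the difference by \<open>q\<close> completes \<open>F(q x, y)\<close> to an automorphism.\<close>

lemma VA2_subst_xy_const2_mult_var_x:
  assumes R: "cring R" and q: "q \<in> non_zero_divisors R" and F: "F \<in> VA2 R"
    and f: "phi1 R q (at_x0 R F) \<in> VA1 (quot R q)"
  shows "subst_xy R F (const2 R q \<otimes>\<^bsub>poly2 R\<^esub> var_x R) (var_y R) \<in> VA2 R"
proof -
  interpret S: cring "poly2 R" by (intro cring_UP R)
  have qR: "q \<in> carrier R" using q by (simp add: non_zero_divisors_def)
  have A: "cring (quot R q)" by (rule cring_quot[OF R qR])
  interpret SA: cring "poly2 (quot R q)" by (intro cring_UP A)
  let ?c = "const2 R q"
  have c: "?c \<in> carrier (poly2 R)" using R qR by simp
  have cnz: "?c \<in> non_zero_divisors (poly2 R)" by (rule const2_non_zero_divisor[OF R q])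
  have xy: "var_x R \<in> carrier (poly2 R)" "var_y R \<in> carrier (poly2 R)" using R by simp_all
  obtain N X Y where FN: "F \<in> carrier (poly2 R)" "N \<in> carrier (poly2 R)"
    and XY: "X \<in> carrier (poly2 R)" "Y \<in> carrier (poly2 R)"
    and inv: "subst_xy R X N F = var_x R" "subst_xy R Y N F = var_y R"
      "subst_xy R N X Y = var_x R" "subst_xy R F X Y = var_y R"
    using F unfolding VA2_iff[OF R] by blast
  have atF: "at_x0 R F \<in> carrier (UP R)" and atN: "at_x0 R N \<in> carrier (UP R)"
    using ring_hom_closed[OF at_x0_hom[OF R]] FN by simp_all
  obtain h where h: "h \<in> carrier (UP R)"
    and fh: "subst1 (quot R q) (phi1 R q (at_x0 R F)) (phi1 R q h) = var1 (quot R q)"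
    and hf: "subst1 (quot R q) (phi1 R q h) (phi1 R q (at_x0 R F)) = var1 (quot R q)"
    by (rule VA1_lift_inverse[OF R qR atF f])
  define B where "B = subst1 R (at_x0 R N) h"
  define qx where "qx = ?c \<otimes>\<^bsub>poly2 R\<^esub> var_x R"
  define u where "u = subst_xy R F qx (var_y R)"
  define M where "M = subst_xy R N qx (var_y R)"
  \<comment> \<open>The quotient \<open>G\<close> will satisfy \<open>M = q G + B(u)\<close>, so the
    value of \<open>w\<close> at \<open>(G, u)\<close> is \<open>M\<close>. Consequently
    \<open>X(w, y)\<close> and \<open>Y(w, y)\<close> take the values \<open>q x\<close> and
    \<open>y\<close> there, and the inverse is found once \<open>X1\<close> is divided by
    \<open>q\<close>.\<close>
  define w where "w = qx \<oplus>\<^bsub>poly2 R\<^esub> incl_y R B"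
  define X1 where "X1 = subst_xy R X w (var_y R)"
  define Y' where "Y' = subst_xy R Y w (var_y R)"
  have B: "B \<in> carrier (UP R)" using R atN h by (simp add: B_def)
  have iB: "incl_y R B \<in> carrier (poly2 R)" using R B by simp
  have qx: "qx \<in> carrier (poly2 R)" using c xy by (simp add: qx_def)
  have cl: "u \<in> carrier (poly2 R)" "M \<in> carrier (poly2 R)" "w \<in> carrier (poly2 R)"
    "X1 \<in> carrier (poly2 R)" "Y' \<in> carrier (poly2 R)"
    using R FN XY qx xy iB by (simp_all add: u_def M_def w_def X1_def Y'_def)
  note ph1 = ring_hom_closed[OF phi1_hom[OF R qR]]
  note ph2 = ring_hom_closed[OF phi2_hom[OF R qR]]
  \<comment> \<open>Modulo \<open>q\<close>, \<open>u\<close> is \<open>F(0, y)\<close>, so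
    \<open>B(u) = N(0, h(F(0, y))) = N(0, y)\<close>, which is also the reduction of
    \<open>M\<close>.\<close>
  have "phi2 R q M = phi2 R q (subst2 R B u)"
  proof -
    have "phi2 R q (subst2 R B u) =
        subst2 (quot R q) (subst1 (quot R q) (phi1 R q (at_x0 R N)) (phi1 R q h))
          (incl_y (quot R q) (phi1 R q (at_x0 R F)))"
      using phi2_subst_xy_const2_mult_var_x[OF R qR FN(1), folded qx_def, folded u_def]
      by (simp add: phi2_subst2[OF R qR B cl(1)]) (simp add: B_def phi1_subst1[OF R qR atN h])
    also have "\<dots> = subst2 (quot R q) (phi1 R q (at_x0 R N)) (incl_y (quot R q) (var1 (quot R q)))"
      using A atN h atF ph1 by (simp add: subst2_incl_y subst1_subst1 hf)
    also have "\<dots> = incl_y (quot R q) (phi1 R q (at_x0 R N))"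
      using subst2_var_y[OF A ph1[OF atN]] by (simp add: var_y_def)
    finally show ?thesis
      using phi2_subst_xy_const2_mult_var_x[OF R qR FN(2), folded qx_def, folded M_def] by simp
  qed
  then obtain G where G: "G \<in> carrier (poly2 R)" "M = ?c \<otimes>\<^bsub>poly2 R\<^esub> G \<oplus>\<^bsub>poly2 R\<^esub> subst2 R B u"
    using phi2_eqD[OF R qR cl(2) subst2_closed[OF R cl(1) B]] by blast
  have ih: "incl_y R h \<in> carrier (poly2 R)" using R h by simp
  \<comment> \<open>Modulo \<open>q\<close>, \<open>w\<close> is \<open>B = N(0, h)\<close> and
    \<open>y\<close> is \<open>F(0, h)\<close>. So \<open>X1\<close> reduces to the value of
    \<open>X(N, F) = x\<close> at \<open>(0, h)\<close>, which is zero.\<close>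
  have "phi2 R q X1 = \<zero>\<^bsub>poly2 (quot R q)\<^esub>"
  proof -
    have "subst_xy R X (incl_y R B) (incl_y R (subst1 R (at_x0 R F) h))
        = subst_xy R (subst_xy R X N F) \<zero>\<^bsub>poly2 R\<^esub> (incl_y R h)"
      unfolding B_def subst_xy_zero_incl_y[OF R FN(1) h, symmetric] subst_xy_zero_incl_y[OF R FN(2) h, symmetric]
      using R XY FN ih by (simp add: subst_xy_subst_xy)
    also have "\<dots> = \<zero>\<^bsub>poly2 R\<^esub>" using R ih by (simp add: inv subst_xy_var_x)
    finally have "phi2 R q (subst_xy R X (incl_y R B) (incl_y R (subst1 R (at_x0 R F) h)))
        = \<zero>\<^bsub>poly2 (quot R q)\<^esub>"
      using ring_hom_zero[OF phi2_hom[OF R qR] S.ring_axioms SA.ring_axioms] by simp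
    moreover have "phi2 R q (incl_y R (subst1 R (at_x0 R F) h)) = var_y (quot R q)"
      using R qR atF h by (simp add: phi2_incl_y phi1_subst1 fh var_y_def)
    moreover have "phi2 R q w = phi2 R q (incl_y R B)"
      using qx iB ph2 phi2_const2_mult[OF R qR xy(1), folded qx_def]
      by (simp add: w_def ring_hom_add[OF phi2_hom[OF R qR]])
    ultimately show ?thesis
      using R qR XY iB atF h cl xy by (simp add: X1_def phi2_subst_xy phi2_var_y)
  qed
  then obtain X' where X': "X' \<in> carrier (poly2 R)" "X1 = ?c \<otimes>\<^bsub>poly2 R\<^esub> X'"
    using phi2_eq_zeroD[OF R qR cl(4)] by blast
  note closed = FN XY xy c qx iB B cl G(1) X'(1) R
  \<comment> \<open>In the labels from here on, \<open>T\<close> stands for substituting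
    \<open>(G, u)\<close> and \<open>U\<close> for substituting \<open>(X', Y')\<close>.\<close>
  have Tw: "subst_xy R w G u = M"
    using closed qR by (simp add: w_def qx_def subst_xy_add subst_xy_mult subst_xy_const2 subst_xy_var_x
        subst_xy_incl_y G(2))
  have TX1: "subst_xy R X1 G u = qx"
  proof -
    have "subst_xy R X1 G u = subst_xy R X M u"
      using closed by (simp add: X1_def subst_xy_subst_xy Tw subst_xy_var_y)
    also have "\<dots> = subst_xy R (subst_xy R X N F) qx (var_y R)"
      using closed by (simp add: M_def u_def subst_xy_subst_xy)
    also have "\<dots> = qx" using closed by (simp add: inv subst_xy_var_x)
    finally show ?thesis .
  qed
  have TX: "subst_xy R X' G u = var_x R"
  proof (rule S.non_zero_divisor_cancel[OF cnz])
    have "?c \<otimes>\<^bsub>poly2 R\<^esub> subst_xy R X' G u = subst_xy R X1 G u"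
      using closed qR by (simp add: X'(2) subst_xy_mult subst_xy_const2)
    thus "?c \<otimes>\<^bsub>poly2 R\<^esub> subst_xy R X' G u = ?c \<otimes>\<^bsub>poly2 R\<^esub> var_x R"
      by (simp add: TX1 qx_def)
  qed (use closed in simp_all)
  have TY: "subst_xy R Y' G u = var_y R"
  proof -
    have "subst_xy R Y' G u = subst_xy R Y M u"
      using closed by (simp add: Y'_def subst_xy_subst_xy Tw subst_xy_var_y)
    also have "\<dots> = subst_xy R (subst_xy R Y N F) qx (var_y R)"
      using closed by (simp add: M_def u_def subst_xy_subst_xy)
    also have "\<dots> = var_y R" using closed by (simp add: inv subst_xy_var_y)
    finally show ?thesis .
  qed
  have Uqx: "subst_xy R qx X' Y' = X1"
    using closed qR by (simp add: qx_def subst_xy_mult subst_xy_const2 subst_xy_var_x X'(2))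
  have Uu: "subst_xy R u X' Y' = var_y R"
  proof -
    have "subst_xy R u X' Y' = subst_xy R F X1 Y'"
      using closed by (simp add: u_def subst_xy_subst_xy Uqx subst_xy_var_y)
    also have "\<dots> = subst_xy R (subst_xy R F X Y) w (var_y R)"
      using closed by (simp add: X1_def Y'_def subst_xy_subst_xy)
    also have "\<dots> = var_y R" using closed by (simp add: inv subst_xy_var_y)
    finally show ?thesis .
  qed
  have UM: "subst_xy R M X' Y' = w"
  proof -
    have "subst_xy R M X' Y' = subst_xy R N X1 Y'"
      using closed by (simp add: M_def subst_xy_subst_xy Uqx subst_xy_var_y)
    also have "\<dots> = subst_xy R (subst_xy R N X Y) w (var_y R)"
      using closed by (simp add: X1_def Y'_def subst_xy_subst_xy)
    also have "\<dots> = w" using closed by (simp add: inv subst_xy_var_x)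
    finally show ?thesis .
  qed
  \<comment> \<open>Substitution into \<open>M = q G + B(u)\<close> gives
    \<open>w = q G(X', Y') + B(y)\<close>; compare this with the definition of \<open>w\<close> and
    cancel \<open>q\<close>.\<close>
  have UG: "subst_xy R G X' Y' = var_x R"
  proof (rule S.non_zero_divisor_cancel[OF cnz])
    have "?c \<otimes>\<^bsub>poly2 R\<^esub> subst_xy R G X' Y' \<oplus>\<^bsub>poly2 R\<^esub> incl_y R B = subst_xy R M X' Y'"
      using closed qR
      by (simp add: G(2) subst_xy_add subst_xy_mult subst_xy_const2 subst_xy_subst2 Uu subst2_var_y)
    hence "?c \<otimes>\<^bsub>poly2 R\<^esub> subst_xy R G X' Y' \<oplus>\<^bsub>poly2 R\<^esub> incl_y R B
        = ?c \<otimes>\<^bsub>poly2 R\<^esub> var_x R \<oplus>\<^bsub>poly2 R\<^esub> incl_y R B"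
      by (simp add: UM w_def qx_def)
    thus "?c \<otimes>\<^bsub>poly2 R\<^esub> subst_xy R G X' Y' = ?c \<otimes>\<^bsub>poly2 R\<^esub> var_x R"
      using closed by simp
  qed (use closed in simp_all)
  show ?thesis
    unfolding VA2_iff[OF R] qx_def[symmetric] u_def[symmetric]
    using cl(1,5) G(1) X'(1) TX TY UG Uu by blast
qed

section \<open>Necessity: reducing coordinates and descending to one variable\<close>

lemma VA2_phi2:
  assumes R: "cring R" and p: "p \<in> carrier R" and F: "F \<in> VA2 R"
  shows "phi2 R p F \<in> VA2 (quot R p)"
proof -
  have A: "cring (quot R p)" by (rule cring_quot[OF R p])
  obtain N X Y where c: "F \<in> carrier (poly2 R)" "N \<in> carrier (poly2 R)"
      "X \<in> carrier (poly2 R)" "Y \<in> carrier (poly2 R)"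
    and inv: "subst_xy R X N F = var_x R" "subst_xy R Y N F = var_y R"
      "subst_xy R N X Y = var_x R" "subst_xy R F X Y = var_y R"
    using F unfolding VA2_iff[OF R] by blast
  have ph: "phi2 R p F \<in> carrier (poly2 (quot R p))" "phi2 R p N \<in> carrier (poly2 (quot R p))"
      "phi2 R p X \<in> carrier (poly2 (quot R p))" "phi2 R p Y \<in> carrier (poly2 (quot R p))"
    by (rule ring_hom_closed[OF phi2_hom[OF R p]], fact)+
  have "subst_xy (quot R p) (phi2 R p X) (phi2 R p N) (phi2 R p F) = var_x (quot R p)"
    "subst_xy (quot R p) (phi2 R p Y) (phi2 R p N) (phi2 R p F) = var_y (quot R p)"
    "subst_xy (quot R p) (phi2 R p N) (phi2 R p X) (phi2 R p Y) = var_x (quot R p)"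
    "subst_xy (quot R p) (phi2 R p F) (phi2 R p X) (phi2 R p Y) = var_y (quot R p)"
    using R p c by (simp_all add: phi2_subst_xy[symmetric] inv phi2_var_x phi2_var_y)
  thus ?thesis unfolding VA2_iff[OF A] using ph by blast
qed

lemma VA1_if_subst2_eq_var_y:
  assumes R: "cring R" and W: "W \<in> carrier (UP R)" and H: "H \<in> carrier (poly2 R)"
    and e: "subst2 R W H = var_y R"
  shows "W \<in> VA1 R"
proof -
  have "subst1 R W (at_x0 R H) = var1 R"
    using at_x0_subst2[OF R W H] by (simp add: e at_x0_var_y[OF R])
  moreover have "at_x0 R H \<in> carrier (UP R)" by (rule ring_hom_closed[OF at_x0_hom[OF R] H])
  ultimately show ?thesis unfolding VA1_iff[OF R] using W by blast
qed

text \<open>If \<open>(X, Y)\<close> inverts an automorphism sending \<open>y\<close> to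
  \<open>W(y)\<close>, its second component satisfies \<open>W(Y) = y\<close>.\<close>

lemma VA1_if_incl_y_VA2:
  assumes R: "cring R" and W: "W \<in> carrier (UP R)" and VA: "incl_y R W \<in> VA2 R"
  shows "W \<in> VA1 R"
proof -
  obtain X Y where c: "X \<in> carrier (poly2 R)" "Y \<in> carrier (poly2 R)"
    and e: "subst_xy R (incl_y R W) X Y = var_y R"
    using VA unfolding VA2_iff[OF R] by blast
  show ?thesis
    using VA1_if_subst2_eq_var_y[OF R W c(2)] e by (simp add: subst_xy_incl_y[OF R c W])
qed

text \<open>Substituting the inverse \<open>(X, Y)\<close> of \<open>F\<close> into
  \<open>d F = W(L)\<close> gives \<open>W(L(X, Y)) = d y\<close>. Replacing \<open>y\<close> by
  \<open>e y\<close> then removes the unit.\<close>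

lemma VA1_if_unit_mult_VA2:
  assumes R: "cring R" and W: "W \<in> carrier (UP R)" and L: "L \<in> carrier (poly2 R)"
    and d: "d \<in> carrier R" and e: "e \<in> carrier R" "d \<otimes>\<^bsub>R\<^esub> e = \<one>\<^bsub>R\<^esub>"
    and F: "F \<in> VA2 R" and dF: "const2 R d \<otimes>\<^bsub>poly2 R\<^esub> F = subst2 R W L"
  shows "W \<in> VA1 R"
proof -
  interpret S: cring "poly2 R" by (intro cring_UP R)
  have xy: "var_x R \<in> carrier (poly2 R)" "var_y R \<in> carrier (poly2 R)" using R by simp_all
  have ey: "const2 R e \<otimes>\<^bsub>poly2 R\<^esub> var_y R \<in> carrier (poly2 R)" using R e by simp
  obtain X Y where c: "F \<in> carrier (poly2 R)" "X \<in> carrier (poly2 R)" "Y \<in> carrier (poly2 R)"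
    and inv: "subst_xy R F X Y = var_y R"
    using F unfolding VA2_iff[OF R] by blast
  have "subst2 R W (subst_xy R L X Y) = subst_xy R (subst2 R W L) X Y"
    using R c W L by (simp add: subst_xy_subst2)
  also have "\<dots> = const2 R d \<otimes>\<^bsub>poly2 R\<^esub> var_y R"
    using R c d by (simp add: dF[symmetric] subst_xy_mult subst_xy_const2 inv)
  finally have "subst2 R W (subst_xy R (subst_xy R L X Y) (var_x R) (const2 R e \<otimes>\<^bsub>poly2 R\<^esub> var_y R))
      = subst_xy R (const2 R d \<otimes>\<^bsub>poly2 R\<^esub> var_y R) (var_x R) (const2 R e \<otimes>\<^bsub>poly2 R\<^esub> var_y R)"
    using R c W L xy ey by (simp add: subst_xy_subst2[symmetric])
  also have "\<dots> = const2 R d \<otimes>\<^bsub>poly2 R\<^esub> const2 R e \<otimes>\<^bsub>poly2 R\<^esub> var_y R"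
    using R d e xy ey by (simp add: subst_xy_mult subst_xy_const2 subst_xy_var_y S.m_assoc)
  also have "const2 R d \<otimes>\<^bsub>poly2 R\<^esub> const2 R e = \<one>\<^bsub>poly2 R\<^esub>"
    unfolding ring_hom_mult[OF const2_hom[OF R] d e(1), symmetric] e(2)
    by (rule ring_hom_one[OF const2_hom[OF R]])
  also have "\<one>\<^bsub>poly2 R\<^esub> \<otimes>\<^bsub>poly2 R\<^esub> var_y R = var_y R" using xy by simp
  finally show ?thesis
    using R c L xy ey by (intro VA1_if_subst2_eq_var_y[OF R W]) simp_all
qed

section \<open>Sufficiency: the automorphism built from comaximality\<close>

text \<open>One relation \<open>d a + q b = 1\<close> is read modulo \<open>q\<close> and modulo
  \<open>d\<close>; each reading kills one summand.\<close>

lemma PIdl_comaximalE: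
  assumes R: "cring R" and d: "d \<in> carrier R" and q: "q \<in> carrier R"
    and co: "PIdl\<^bsub>R\<^esub> d <+>\<^bsub>R\<^esub> PIdl\<^bsub>R\<^esub> q = carrier R"
  obtains a b where "a \<in> carrier R" "b \<in> carrier R"
    "phi R q d \<otimes>\<^bsub>quot R q\<^esub> phi R q a = \<one>\<^bsub>quot R q\<^esub>"
    "phi R d q \<otimes>\<^bsub>quot R d\<^esub> phi R d b = \<one>\<^bsub>quot R d\<^esub>"
proof -
  interpret cring R by (rule R)
  interpret Aq: cring "quot R q" by (rule cring_quot[OF R q])
  interpret Ad: cring "quot R d" by (rule cring_quot[OF R d])
  have "\<one>\<^bsub>R\<^esub> \<in> PIdl\<^bsub>R\<^esub> d <+>\<^bsub>R\<^esub> PIdl\<^bsub>R\<^esub> q" using co by simp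
  then obtain a b where ab: "a \<in> carrier R" "b \<in> carrier R"
    and "\<one>\<^bsub>R\<^esub> = a \<otimes>\<^bsub>R\<^esub> d \<oplus>\<^bsub>R\<^esub> b \<otimes>\<^bsub>R\<^esub> q"
    unfolding set_add_def' cgenideal_def by blast
  hence e: "d \<otimes>\<^bsub>R\<^esub> a \<oplus>\<^bsub>R\<^esub> q \<otimes>\<^bsub>R\<^esub> b = \<one>\<^bsub>R\<^esub>" using d q by (simp add: m_comm)
  have "phi R p d \<otimes>\<^bsub>quot R p\<^esub> phi R p a \<oplus>\<^bsub>quot R p\<^esub> phi R p q \<otimes>\<^bsub>quot R p\<^esub> phi R p b = \<one>\<^bsub>quot R p\<^esub>"
    if p: "p \<in> carrier R" for p
    using arg_cong[OF e, of "phi R p"] ab d q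
    by (simp add: ring_hom_add[OF phi_hom[OF R p]] ring_hom_mult[OF phi_hom[OF R p]]
        ring_hom_one[OF phi_hom[OF R p]])
  from this[OF q] this[OF d] show ?thesis
    using ab d q ring_hom_closed[OF phi_hom[OF R q]] ring_hom_closed[OF phi_hom[OF R d]]
    by (intro that[OF ab]) (simp_all add: phi_self[OF R])
qed

text \<open>With \<open>h\<close> inverse to \<open>Q2\<close> modulo \<open>q\<close> and \<open>L = d x + Q1(y)\<close>, the quotient \<open>N\<close> of
  \<open>L - h(d F)\<close> by \<open>q\<close> completes \<open>F\<close> to an automorphism. The inverse \<open>(V, Y)\<close> is found from
  \<open>L' = h(d y) + q x\<close>: \<open>q Y = d y - Q2(L')\<close> and \<open>d V = L' - Q1(Y)\<close>. The last division is possible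
  since the hypothesis makes \<open>-Q2/q\<close> a left inverse, hence also a right inverse, of \<open>Q1\<close>
  modulo \<open>d\<close>.\<close>

lemma VA2_of_comaximal:
  assumes R: "cring R" and d: "d \<in> non_zero_divisors R" and q: "q \<in> non_zero_divisors R"
    and b: "b \<in> carrier R" "phi R d q \<otimes>\<^bsub>quot R d\<^esub> phi R d b = \<one>\<^bsub>quot R d\<^esub>"
    and Q1: "Q1 \<in> carrier (UP R)" and Q2: "Q2 \<in> carrier (UP R)"
    and z: "phi1 R d (const1 R q \<otimes>\<^bsub>UP R\<^esub> var1 R \<oplus>\<^bsub>UP R\<^esub> subst1 R Q2 Q1) = \<zero>\<^bsub>UP (quot R d)\<^esub>"
    and VA: "phi1 R q Q2 \<in> VA1 (quot R q)"
    and F: "F \<in> carrier (poly2 R)"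
    and dF: "const2 R d \<otimes>\<^bsub>poly2 R\<^esub> F = const2 R q \<otimes>\<^bsub>poly2 R\<^esub> var_y R \<oplus>\<^bsub>poly2 R\<^esub>
      subst2 R Q2 (const2 R d \<otimes>\<^bsub>poly2 R\<^esub> var_x R \<oplus>\<^bsub>poly2 R\<^esub> incl_y R Q1)"
  shows "F \<in> VA2 R"
proof -
  interpret S: cring "poly2 R" by (intro cring_UP R)
  have dR: "d \<in> carrier R" and qR: "q \<in> carrier R" using d q by (simp_all add: non_zero_divisors_def)
  have Ad: "cring (quot R d)" and Aq: "cring (quot R q)" using cring_quot[OF R dR] cring_quot[OF R qR] by simp_all
  interpret Pd: cring "UP (quot R d)" by (intro cring_UP Ad)
  interpret Sd: cring "poly2 (quot R d)" by (intro cring_UP Ad)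
  interpret Sq: cring "poly2 (quot R q)" by (intro cring_UP Aq)
  define x where "x = var_x R"
  define y where "y = var_y R"
  define cd where "cd = const2 R d"
  define cq where "cq = const2 R q"
  have xy: "x \<in> carrier (poly2 R)" "y \<in> carrier (poly2 R)" using R by (simp_all add: x_def y_def)
  have cdq: "cd \<in> carrier (poly2 R)" "cq \<in> carrier (poly2 R)" using R dR qR by (simp_all add: cd_def cq_def)
  have nz: "cd \<in> non_zero_divisors (poly2 R)" "cq \<in> non_zero_divisors (poly2 R)"
    using const2_non_zero_divisor[OF R] d q by (simp_all add: cd_def cq_def)
  obtain h where h: "h \<in> carrier (UP R)"
    and Q2h: "subst1 (quot R q) (phi1 R q Q2) (phi1 R q h) = var1 (quot R q)"
    and hQ2: "subst1 (quot R q) (phi1 R q h) (phi1 R q Q2) = var1 (quot R q)"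
    by (rule VA1_lift_inverse[OF R qR Q2 VA])
  note ph1q = ring_hom_closed[OF phi1_hom[OF R qR]] and ph2q = ring_hom_closed[OF phi2_hom[OF R qR]]
  note ph1d = ring_hom_closed[OF phi1_hom[OF R dR]] and ph2d = ring_hom_closed[OF phi2_hom[OF R dR]]
  define L where "L = cd \<otimes>\<^bsub>poly2 R\<^esub> x \<oplus>\<^bsub>poly2 R\<^esub> incl_y R Q1"
  define L' where "L' = cq \<otimes>\<^bsub>poly2 R\<^esub> x \<oplus>\<^bsub>poly2 R\<^esub> subst2 R h (cd \<otimes>\<^bsub>poly2 R\<^esub> y)"
  have iQ1: "incl_y R Q1 \<in> carrier (poly2 R)" using R Q1 by simp
  have L: "L \<in> carrier (poly2 R)" "L' \<in> carrier (poly2 R)"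
    using R xy cdq h iQ1 by (simp_all add: L_def L'_def)
  have dF: "cd \<otimes>\<^bsub>poly2 R\<^esub> F = cq \<otimes>\<^bsub>poly2 R\<^esub> y \<oplus>\<^bsub>poly2 R\<^esub> subst2 R Q2 L"
    using dF by (simp add: cd_def cq_def x_def y_def L_def)
  have kill: "phi2 R q (cq \<otimes>\<^bsub>poly2 R\<^esub> P \<oplus>\<^bsub>poly2 R\<^esub> Q) = phi2 R q Q"
    if "P \<in> carrier (poly2 R)" "Q \<in> carrier (poly2 R)" for P Q
    using that cdq ph2q[OF that(2)] phi2_const2_mult[OF R qR that(1)]
    by (simp add: ring_hom_add[OF phi2_hom[OF R qR]] cq_def)
  \<comment> \<open>Modulo \<open>q\<close> the defining equation becomes
    \<open>d F = Q2(L)\<close>, and applying \<open>h\<close> recovers \<open>L\<close>.\<close>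
  have "phi2 R q L = phi2 R q (subst2 R h (cd \<otimes>\<^bsub>poly2 R\<^esub> F))"
  proof -
    have "phi2 R q (subst2 R h (cd \<otimes>\<^bsub>poly2 R\<^esub> F)) =
        subst2 (quot R q) (phi1 R q h) (phi2 R q (subst2 R Q2 L))"
      using R h Q2 cdq F L xy by (simp add: phi2_subst2[OF R qR h]) (simp add: dF kill)
    also have "\<dots> = subst2 (quot R q) (phi1 R q h) (subst2 (quot R q) (phi1 R q Q2) (phi2 R q L))"
      using R qR Q2 L by (simp add: phi2_subst2)
    also have "\<dots> = phi2 R q L"
      using subst2_subst1[OF Aq ph1q[OF h] ph1q[OF Q2] ph2q[OF L(1)]] subst2_var1[OF Aq ph2q[OF L(1)]]
      by (simp add: hQ2)
    finally show ?thesis by simp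
  qed
  then obtain N where N: "N \<in> carrier (poly2 R)"
    "L = cq \<otimes>\<^bsub>poly2 R\<^esub> N \<oplus>\<^bsub>poly2 R\<^esub> subst2 R h (cd \<otimes>\<^bsub>poly2 R\<^esub> F)"
    using phi2_eqD[OF R qR L(1) subst2_closed[OF R S.m_closed[OF cdq(1) F] h]] unfolding cq_def by blast
  \<comment> \<open>Here the other composite is used: modulo \<open>q\<close>,
    \<open>Q2(L') = Q2(h(d y)) = d y\<close>.\<close>
  have "phi2 R q (cd \<otimes>\<^bsub>poly2 R\<^esub> y) = phi2 R q (subst2 R Q2 L')"
  proof -
    have "phi2 R q (subst2 R Q2 L') = subst2 (quot R q) (phi1 R q Q2) (phi2 R q (subst2 R h (cd \<otimes>\<^bsub>poly2 R\<^esub> y)))"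
      using R h Q2 cdq L xy by (simp add: phi2_subst2[OF R qR Q2]) (simp add: L'_def kill)
    also have "\<dots> = subst2 (quot R q) (phi1 R q Q2)
        (subst2 (quot R q) (phi1 R q h) (phi2 R q (cd \<otimes>\<^bsub>poly2 R\<^esub> y)))"
      using R qR h cdq xy by (simp add: phi2_subst2)
    also have "\<dots> = phi2 R q (cd \<otimes>\<^bsub>poly2 R\<^esub> y)"
      using subst2_subst1[OF Aq ph1q[OF Q2] ph1q[OF h] ph2q] subst2_var1[OF Aq ph2q] cdq xy
      by (simp add: Q2h)
    finally show ?thesis by simp
  qed
  then obtain Y where Y: "Y \<in> carrier (poly2 R)"
    "cd \<otimes>\<^bsub>poly2 R\<^esub> y = cq \<otimes>\<^bsub>poly2 R\<^esub> Y \<oplus>\<^bsub>poly2 R\<^esub> subst2 R Q2 L'"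
    using phi2_eqD[OF R qR S.m_closed[OF cdq(1) xy(2)] subst2_closed[OF R L(2) Q2]]
    unfolding cq_def by blast
  have "phi2 R d L' = phi2 R d (subst2 R Q1 Y)"
  proof -
    let ?A = "quot R d"
    define e where "e = const1 ?A (phi R d b)"
    define W where "W = \<ominus>\<^bsub>UP ?A\<^esub> (e \<otimes>\<^bsub>UP ?A\<^esub> phi1 R d Q2)"
    have ph: "phi R d b \<in> carrier ?A" "phi R d q \<in> carrier ?A"
      using ring_hom_closed[OF phi_hom[OF R dR]] b qR by simp_all
    have e: "e \<in> carrier (UP ?A)" using Ad ph by (simp add: e_def)
    have q1: "phi1 R d Q1 \<in> carrier (UP ?A)" "phi1 R d Q2 \<in> carrier (UP ?A)" using ph1d Q1 Q2 by simp_all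
    have W: "W \<in> carrier (UP ?A)" using e q1 by (simp add: W_def)
    let ?q = "const1 ?A (phi R d q)"
    have qc: "?q \<in> carrier (UP ?A)" using Ad ph by simp
    have eq: "e \<otimes>\<^bsub>UP ?A\<^esub> ?q = \<one>\<^bsub>UP ?A\<^esub>"
      unfolding Pd.m_comm[OF e qc] unfolding e_def ring_hom_mult[OF const1_hom[OF Ad] ph(2,1), symmetric] b(2)
      by (rule ring_hom_one[OF const1_hom[OF Ad]])
    have v: "var1 ?A \<in> carrier (UP ?A)" using Ad by simp
    have s: "subst1 ?A (phi1 R d Q2) (phi1 R d Q1) \<in> carrier (UP ?A)" using Ad q1 by simp
    have "?q \<otimes>\<^bsub>UP ?A\<^esub> var1 ?A \<oplus>\<^bsub>UP ?A\<^esub> subst1 ?A (phi1 R d Q2) (phi1 R d Q1) = \<zero>\<^bsub>UP ?A\<^esub>"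
      using z R dR qR Q1 Q2 cring.cring_simprules(5)[OF cring_UP[OF R]]
      by (simp add: ring_hom_add[OF phi1_hom[OF R dR]] ring_hom_mult[OF phi1_hom[OF R dR]]
          phi1_const1 phi1_var1 phi1_subst1)
    hence qv: "\<ominus>\<^bsub>UP ?A\<^esub> subst1 ?A (phi1 R d Q2) (phi1 R d Q1) = ?q \<otimes>\<^bsub>UP ?A\<^esub> var1 ?A"
      using Pd.minus_equality[of "?q \<otimes>\<^bsub>UP ?A\<^esub> var1 ?A" "subst1 ?A (phi1 R d Q2) (phi1 R d Q1)"] qc v s by simp
    interpret h1: ring_hom_cring "UP ?A" "UP ?A" "\<lambda>P. subst1 ?A P (phi1 R d Q1)"
      by (intro ring_hom_cring.intro ring_hom_cring_axioms.intro Pd.cring_axioms subst1_hom[OF Ad q1(1)])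
    have "subst1 ?A W (phi1 R d Q1) = e \<otimes>\<^bsub>UP ?A\<^esub> (\<ominus>\<^bsub>UP ?A\<^esub> subst1 ?A (phi1 R d Q2) (phi1 R d Q1))"
      using Ad e q1 s ph by (simp add: W_def Pd.r_minus) (simp add: e_def subst1_const1)
    also have "\<dots> = var1 ?A" using e qc v by (simp add: qv Pd.m_assoc[symmetric] eq)
    finally have Q1W: "subst1 ?A (phi1 R d Q1) W = var1 ?A"
      by (rule subst1_left_inverse[OF Ad W q1(1)])
    have pY: "phi2 R d Y \<in> carrier (poly2 ?A)" and pL: "phi2 R d L' \<in> carrier (poly2 ?A)"
      using ph2d Y L by simp_all
    interpret h2: ring_hom_cring "UP ?A" "poly2 ?A" "\<lambda>P. subst2 ?A P (phi2 R d L')"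
      by (intro ring_hom_cring.intro ring_hom_cring_axioms.intro Pd.cring_axioms Sd.cring_axioms
          subst2_hom[OF Ad pL])
    let ?q2 = "const2 ?A (phi R d q)" and ?e2 = "const2 ?A (phi R d b)"
    let ?s = "subst2 ?A (phi1 R d Q2) (phi2 R d L')"
    have c2: "?q2 \<in> carrier (poly2 ?A)" "?e2 \<in> carrier (poly2 ?A)" "?s \<in> carrier (poly2 ?A)"
      using Ad ph q1 pL by simp_all
    have eq2: "?e2 \<otimes>\<^bsub>poly2 ?A\<^esub> ?q2 = \<one>\<^bsub>poly2 ?A\<^esub>"
      unfolding Sd.m_comm[OF c2(2,1)] ring_hom_mult[OF const2_hom[OF Ad] ph(2,1), symmetric] b(2)
      by (rule ring_hom_one[OF const2_hom[OF Ad]])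
    \<comment> \<open>Reducing \<open>d y = q Y + Q2(L')\<close> modulo \<open>d\<close> and
      dividing by \<open>-q\<close> gives \<open>Y = W(L')\<close>, hence
      \<open>Q1(Y) = Q1(W(L')) = L'\<close>.\<close>
    have "?q2 \<otimes>\<^bsub>poly2 ?A\<^esub> phi2 R d Y \<oplus>\<^bsub>poly2 ?A\<^esub> ?s = \<zero>\<^bsub>poly2 ?A\<^esub>"
      using arg_cong[OF Y(2), of "phi2 R d"] phi2_const2_mult[OF R dR xy(2)] R dR qR cdq Y(1) L Q2
      by (simp add: ring_hom_add[OF phi2_hom[OF R dR]] ring_hom_mult[OF phi2_hom[OF R dR]] phi2_subst2)
        (simp add: cd_def cq_def phi2_const2)
    hence qY: "\<ominus>\<^bsub>poly2 ?A\<^esub> ?s = ?q2 \<otimes>\<^bsub>poly2 ?A\<^esub> phi2 R d Y"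
      using Sd.minus_equality[of "?q2 \<otimes>\<^bsub>poly2 ?A\<^esub> phi2 R d Y" ?s] c2 pY by simp
    have "subst2 ?A W (phi2 R d L') = ?e2 \<otimes>\<^bsub>poly2 ?A\<^esub> (\<ominus>\<^bsub>poly2 ?A\<^esub> ?s)"
      using Ad e q1 c2 pL ph by (simp add: W_def Sd.r_minus) (simp add: e_def subst2_const1)
    also have "\<dots> = phi2 R d Y" using c2 pY by (simp add: qY Sd.m_assoc[symmetric] eq2)
    finally have WL: "phi2 R d Y = subst2 ?A W (phi2 R d L')" by simp
    have "phi2 R d (subst2 R Q1 Y) = subst2 ?A (phi1 R d Q1) (subst2 ?A W (phi2 R d L'))"
      using R dR Q1 Y(1) by (simp add: phi2_subst2 WL)
    also have "\<dots> = phi2 R d L'"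
      using subst2_subst1[OF Ad q1(1) W pL] subst2_var1[OF Ad pL] by (simp add: Q1W)
    finally show ?thesis by simp
  qed
  then obtain V where V: "V \<in> carrier (poly2 R)"
    "L' = cd \<otimes>\<^bsub>poly2 R\<^esub> V \<oplus>\<^bsub>poly2 R\<^esub> subst2 R Q1 Y"
    using phi2_eqD[OF R dR L(2) subst2_closed[OF R Y(1) Q1]] unfolding cd_def by blast
  note closed = xy cdq F N(1) Y(1) V(1) L h Q1 Q2 iQ1 R
  have cc: "subst_xy R cd P Q = cd" "subst_xy R cq P Q = cq"
    if "P \<in> carrier (poly2 R)" "Q \<in> carrier (poly2 R)" for P Q
    using that R dR qR by (simp_all add: cd_def cq_def subst_xy_const2)
  have xx: "subst_xy R x P Q = P" "subst_xy R y P Q = Q"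
    if "P \<in> carrier (poly2 R)" "Q \<in> carrier (poly2 R)" for P Q
    using that R by (simp_all add: x_def y_def subst_xy_var_x subst_xy_var_y)
  note push = subst_xy_add subst_xy_mult subst_xy_subst2 subst_xy_incl_y cc xx
  \<comment> \<open>Labels with \<open>T\<close> refer to substituting \<open>(N, F)\<close>, those
    with \<open>U\<close> to \<open>(V, Y)\<close>. The first substitution carries \<open>L'\<close>
    to \<open>L\<close> and the second \<open>L\<close> to \<open>L'\<close>, directly by the
    equations defining \<open>N\<close> and \<open>V\<close>. The remaining identities follow by
    substituting into the equations for \<open>Y\<close>, \<open>V\<close>, \<open>F\<close> and
    \<open>N\<close> and cancelling \<open>d\<close> or \<open>q\<close>.\<close>
  have TL: "subst_xy R L' N F = L"
    using closed by (subst N(2)) (simp add: L'_def push)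
  have TY: "subst_xy R Y N F = y"
  proof (rule S.non_zero_divisor_cancel[OF nz(2)])
    have "cq \<otimes>\<^bsub>poly2 R\<^esub> subst_xy R Y N F \<oplus>\<^bsub>poly2 R\<^esub> subst2 R Q2 L = subst_xy R (cd \<otimes>\<^bsub>poly2 R\<^esub> y) N F"
      unfolding Y(2) using closed by (simp add: push TL)
    also have "\<dots> = cq \<otimes>\<^bsub>poly2 R\<^esub> y \<oplus>\<^bsub>poly2 R\<^esub> subst2 R Q2 L"
      using closed by (simp add: push dF)
    finally show "cq \<otimes>\<^bsub>poly2 R\<^esub> subst_xy R Y N F = cq \<otimes>\<^bsub>poly2 R\<^esub> y" using closed by simp
  qed (use closed in simp_all)
  have TV: "subst_xy R V N F = x"
  proof (rule S.non_zero_divisor_cancel[OF nz(1)])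
    have "cd \<otimes>\<^bsub>poly2 R\<^esub> subst_xy R V N F \<oplus>\<^bsub>poly2 R\<^esub> incl_y R Q1 = subst_xy R L' N F"
      unfolding V(2) using closed subst2_var_y[OF R Q1] by (simp add: push TY) (simp add: y_def)
    also have "\<dots> = cd \<otimes>\<^bsub>poly2 R\<^esub> x \<oplus>\<^bsub>poly2 R\<^esub> incl_y R Q1" by (simp add: TL L_def)
    finally show "cd \<otimes>\<^bsub>poly2 R\<^esub> subst_xy R V N F = cd \<otimes>\<^bsub>poly2 R\<^esub> x" using closed by simp
  qed (use closed in simp_all)
  have UL: "subst_xy R L V Y = L'"
    using closed by (subst V(2)) (simp add: L_def push)
  have UF: "subst_xy R F V Y = y"
  proof (rule S.non_zero_divisor_cancel[OF nz(1)])
    have "cd \<otimes>\<^bsub>poly2 R\<^esub> subst_xy R F V Y = subst_xy R (cd \<otimes>\<^bsub>poly2 R\<^esub> F) V Y"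
      using closed by (simp add: push)
    also have "\<dots> = cd \<otimes>\<^bsub>poly2 R\<^esub> y"
      unfolding dF Y(2) using closed by (simp add: push UL)
    finally show "cd \<otimes>\<^bsub>poly2 R\<^esub> subst_xy R F V Y = cd \<otimes>\<^bsub>poly2 R\<^esub> y" .
  qed (use closed in simp_all)
  have UN: "subst_xy R N V Y = x"
  proof (rule S.non_zero_divisor_cancel[OF nz(2)])
    have "cq \<otimes>\<^bsub>poly2 R\<^esub> subst_xy R N V Y \<oplus>\<^bsub>poly2 R\<^esub> subst2 R h (cd \<otimes>\<^bsub>poly2 R\<^esub> y) = subst_xy R L V Y"
      unfolding N(2) using closed by (simp add: push UF)
    also have "\<dots> = cq \<otimes>\<^bsub>poly2 R\<^esub> x \<oplus>\<^bsub>poly2 R\<^esub> subst2 R h (cd \<otimes>\<^bsub>poly2 R\<^esub> y)" by (simp add: UL L'_def)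
    finally show "cq \<otimes>\<^bsub>poly2 R\<^esub> subst_xy R N V Y = cq \<otimes>\<^bsub>poly2 R\<^esub> x" using closed by simp
  qed (use closed in simp_all)
  show ?thesis
    unfolding VA2_iff[OF R] x_def[symmetric] y_def[symmetric]
    using F N(1) V(1) Y(1) TV TY UN UF by blast
qed

theorem theorem6:
  fixes R :: "('a, 'm) ring_scheme" (structure)
    and d q1 q2 :: 'a
    and Q1 Q2 :: "nat \<Rightarrow> 'a"
    and F :: "nat \<Rightarrow> nat \<Rightarrow> 'a"
  assumes "cring R"
    and "d \<in> non_zero_divisors R"
    and "q1 \<in> non_zero_divisors R"
    and "q2 \<in> non_zero_divisors R"
    and "PIdl d <+> PIdl q2 = carrier R"
    and "Q1 \<in> carrier (poly1 R)"
    and "Q2 \<in> carrier (poly1 R)"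
    and "phi1 R d (const1 R q2 \<otimes>\<^bsub>poly1 R\<^esub> var1 R \<oplus>\<^bsub>poly1 R\<^esub> subst1 R Q2 Q1)
           = \<zero>\<^bsub>poly1 (quot R d)\<^esub>"
    and "F = div_const R d
               (const2 R q2 \<otimes>\<^bsub>poly2 R\<^esub> var_y R \<oplus>\<^bsub>poly2 R\<^esub>
                subst2 R Q2 (const2 R (q1 \<otimes> d) \<otimes>\<^bsub>poly2 R\<^esub> var_x R \<oplus>\<^bsub>poly2 R\<^esub> incl_y R Q1))"
  shows "(F \<in> VA2 R \<longleftrightarrow>
            phi2 R q1 F \<in> VA2 (quot R q1) \<and> phi2 R q2 F \<in> VA2 (quot R q2)) \<and>
         (phi2 R q1 F \<in> VA2 (quot R q1) \<and> phi2 R q2 F \<in> VA2 (quot R q2) \<longleftrightarrow>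
            phi1 R q1 (at_x0 R F) \<in> VA1 (quot R q1) \<and> phi1 R q2 Q2 \<in> VA1 (quot R q2))"
proof -
  note R = assms(1) and d = assms(2) and q1 = assms(3) and q2 = assms(4) and Q1 = assms(6)
    and Q2 = assms(7) and z = assms(8)
  interpret P: cring "UP R" by (intro cring_UP R)
  interpret S: cring "poly2 R" by (intro cring_UP R)
  have dR: "d \<in> carrier R" and q1R: "q1 \<in> carrier R" and q2R: "q2 \<in> carrier R"
    using d q1 q2 by (simp_all add: non_zero_divisors_def)
  have A2: "cring (quot R q2)" and Ad: "cring (quot R d)"
    using cring_quot[OF R q2R] cring_quot[OF R dR] by simp_all
  interpret S2: cring "poly2 (quot R q2)" by (intro cring_UP A2)
  interpret Sd: cring "poly2 (quot R d)" by (intro cring_UP Ad)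
  obtain a b where a: "a \<in> carrier R" "phi R q2 d \<otimes>\<^bsub>quot R q2\<^esub> phi R q2 a = \<one>\<^bsub>quot R q2\<^esub>"
    and b: "b \<in> carrier R" "phi R d q2 \<otimes>\<^bsub>quot R d\<^esub> phi R d b = \<one>\<^bsub>quot R d\<^esub>"
    by (rule PIdl_comaximalE[OF R dR q2R assms(5)])
  have xy: "var_x R \<in> carrier (poly2 R)" "var_y R \<in> carrier (poly2 R)" using R by simp_all
  have c: "const2 R d \<in> carrier (poly2 R)" "const2 R q1 \<in> carrier (poly2 R)"
    "const2 R q2 \<in> carrier (poly2 R)" using R dR q1R q2R by simp_all
  have iQ1: "incl_y R Q1 \<in> carrier (poly2 R)" using R Q1 by simp
  have c2: "const1 R q2 \<in> carrier (UP R)" "var1 R \<in> carrier (UP R)" using R q2R by simp_all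

  define L0 where "L0 = const2 R d \<otimes>\<^bsub>poly2 R\<^esub> var_x R \<oplus>\<^bsub>poly2 R\<^esub> incl_y R Q1"
  define G0 where "G0 = const2 R q2 \<otimes>\<^bsub>poly2 R\<^esub> var_y R \<oplus>\<^bsub>poly2 R\<^esub> subst2 R Q2 L0"
  have L0: "L0 \<in> carrier (poly2 R)" using c xy iQ1 by (simp add: L0_def)
  have sL0: "subst2 R Q2 L0 \<in> carrier (poly2 R)" using R Q2 L0 by simp
  have G0: "G0 \<in> carrier (poly2 R)" using c xy sL0 by (simp add: G0_def)
  \<comment> \<open>Modulo \<open>d\<close> the term \<open>d x\<close> drops out of
    \<open>L0\<close>, so \<open>G0\<close> reduces to the one-variable polynomial in the hypothesis
    on \<open>Q1\<close> and \<open>Q2\<close>.\<close>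
  have "phi2 R d G0 = \<zero>\<^bsub>poly2 (quot R d)\<^esub>"
  proof -
    have L: "phi2 R d L0 = phi2 R d (incl_y R Q1)"
      using phi2_const2_mult[OF R dR xy(1)] ring_hom_closed[OF phi2_hom[OF R dR] iQ1] c xy iQ1
      by (simp add: L0_def ring_hom_add[OF phi2_hom[OF R dR]])
    have s: "subst1 R Q2 Q1 \<in> carrier (UP R)" using R Q1 Q2 by simp
    have "phi2 R d (subst2 R Q2 L0) = phi2 R d (incl_y R (subst1 R Q2 Q1))"
      using R dR Q1 Q2 L0 iQ1 by (simp add: phi2_subst2 L subst2_incl_y[symmetric])
    moreover have "const2 R q2 \<otimes>\<^bsub>poly2 R\<^esub> var_y R = incl_y R (const1 R q2 \<otimes>\<^bsub>UP R\<^esub> var1 R)"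
      by (simp add: ring_hom_mult[OF incl_y_hom[OF R] c2] const2_def var_y_def)
    ultimately have "phi2 R d G0 =
        phi2 R d (incl_y R (const1 R q2 \<otimes>\<^bsub>UP R\<^esub> var1 R) \<oplus>\<^bsub>poly2 R\<^esub> incl_y R (subst1 R Q2 Q1))"
      using R s c2 sL0 by (simp add: G0_def ring_hom_add[OF phi2_hom[OF R dR]])
    also have "\<dots> = incl_y (quot R d)
        (phi1 R d (const1 R q2 \<otimes>\<^bsub>UP R\<^esub> var1 R \<oplus>\<^bsub>UP R\<^esub> subst1 R Q2 Q1))"
      using R dR s c2 by (simp add: ring_hom_add[OF incl_y_hom[OF R], symmetric] phi2_incl_y)
    also have "\<dots> = \<zero>\<^bsub>poly2 (quot R d)\<^esub>"
      unfolding z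
      by (rule ring_hom_zero[OF incl_y_hom[OF Ad] cring.axioms(1)[OF cring_UP[OF Ad]] Sd.ring_axioms])
    finally show ?thesis .
  qed
  then obtain F0 where F0: "F0 \<in> carrier (poly2 R)" "G0 = const2 R d \<otimes>\<^bsub>poly2 R\<^esub> F0"
    using phi2_eq_zeroD[OF R dR G0] by blast

  define qx where "qx = const2 R q1 \<otimes>\<^bsub>poly2 R\<^esub> var_x R"
  have qx: "qx \<in> carrier (poly2 R)" using c xy by (simp add: qx_def)
  define L where "L = const2 R (q1 \<otimes> d) \<otimes>\<^bsub>poly2 R\<^esub> var_x R \<oplus>\<^bsub>poly2 R\<^esub> incl_y R Q1"
  have Leq: "L = const2 R d \<otimes>\<^bsub>poly2 R\<^esub> qx \<oplus>\<^bsub>poly2 R\<^esub> incl_y R Q1"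
    using c xy by (simp add: L_def qx_def ring_hom_mult[OF const2_hom[OF R] q1R dR] S.m_ac)
  have L: "L \<in> carrier (poly2 R)" using c qx iQ1 by (simp add: Leq)
  define G where "G = const2 R q2 \<otimes>\<^bsub>poly2 R\<^esub> var_y R \<oplus>\<^bsub>poly2 R\<^esub> subst2 R Q2 L"
  have sF0: "subst_xy R F0 qx (var_y R) \<in> carrier (poly2 R)" using R F0 qx xy by simp
  have "subst_xy R L0 qx (var_y R) = L"
    using R c xy qx iQ1 Q1 dR
    by (simp add: L0_def Leq subst_xy_add subst_xy_mult subst_xy_const2 subst_xy_var_x
        subst_xy_incl_y subst2_var_y)
  hence "subst_xy R G0 qx (var_y R) = G"
    using R c xy qx Q2 L0 sL0 q2R
    by (simp add: G0_def G_def subst_xy_add subst_xy_mult subst_xy_const2 subst_xy_var_y subst_xy_subst2)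
  hence dF: "const2 R d \<otimes>\<^bsub>poly2 R\<^esub> subst_xy R F0 qx (var_y R) = G"
    using R c xy qx F0 dR by (simp add: F0(2) subst_xy_mult subst_xy_const2)
  \<comment> \<open>The definite description in \<open>div_const\<close> becomes usable only now
    that an actual quotient by \<open>d\<close> is at hand.\<close>
  have F: "F = subst_xy R F0 qx (var_y R)"
    unfolding assms(9) L_def[symmetric] G_def[symmetric] by (rule div_const_eq[OF R d sF0 dF])
  have at: "at_x0 R F = at_x0 R F0"
    unfolding F qx_def by (rule at_x0_subst_xy_const2_mult_var_x[OF R q1R F0(1)])
  have atc: "at_x0 R F0 \<in> carrier (UP R)" by (rule ring_hom_closed[OF at_x0_hom[OF R] F0(1)])

  have iii_i: "F \<in> VA2 R"
    if "phi1 R q1 (at_x0 R F) \<in> VA1 (quot R q1)" "phi1 R q2 Q2 \<in> VA1 (quot R q2)"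
  proof -
    have "F0 \<in> VA2 R"
      by (rule VA2_of_comaximal[OF R d q2 b Q1 Q2 z that(2) F0(1)]) (simp add: F0(2)[symmetric] G0_def L0_def)
    thus ?thesis
      using VA2_subst_xy_const2_mult_var_x[OF R q1 _ that(1)[unfolded at]] by (simp add: F qx_def)
  qed
  have ii_iii_a: "phi1 R q1 (at_x0 R F) \<in> VA1 (quot R q1)" if "phi2 R q1 F \<in> VA2 (quot R q1)"
  proof (rule VA1_if_incl_y_VA2[OF cring_quot[OF R q1R]])
    show "phi1 R q1 (at_x0 R F) \<in> carrier (UP (quot R q1))"
      using ring_hom_closed[OF phi1_hom[OF R q1R] atc] by (simp add: at)
    have "phi2 R q1 F = incl_y (quot R q1) (phi1 R q1 (at_x0 R F))"
      unfolding at unfolding F qx_def by (rule phi2_subst_xy_const2_mult_var_x[OF R q1R F0(1)])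
    with that show "incl_y (quot R q1) (phi1 R q1 (at_x0 R F)) \<in> VA2 (quot R q1)" by simp
  qed
  \<comment> \<open>Modulo \<open>q2\<close> the summand \<open>q2 y\<close> disappears from
    \<open>d F\<close>, and \<open>a\<close> inverts \<open>d\<close> there.\<close>
  have ii_iii_b: "phi1 R q2 Q2 \<in> VA1 (quot R q2)" if VA: "phi2 R q2 F \<in> VA2 (quot R q2)"
  proof (rule VA1_if_unit_mult_VA2[OF A2 _ _ _ _ a(2) VA])
    note ph2 = ring_hom_closed[OF phi2_hom[OF R q2R]]
    show "phi1 R q2 Q2 \<in> carrier (UP (quot R q2))" by (rule ring_hom_closed[OF phi1_hom[OF R q2R] Q2])
    show "phi2 R q2 L \<in> carrier (poly2 (quot R q2))" by (rule ph2[OF L])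
    show "phi R q2 d \<in> carrier (quot R q2)" by (rule ring_hom_closed[OF phi_hom[OF R q2R] dR])
    show "phi R q2 a \<in> carrier (quot R q2)" by (rule ring_hom_closed[OF phi_hom[OF R q2R] a(1)])
    have sL: "subst2 R Q2 L \<in> carrier (poly2 R)" using R Q2 L by simp
    have "const2 (quot R q2) (phi R q2 d) \<otimes>\<^bsub>poly2 (quot R q2)\<^esub> phi2 R q2 F
        = phi2 R q2 (const2 R d \<otimes>\<^bsub>poly2 R\<^esub> F)"
      using R q2R dR c sF0 by (simp add: F ring_hom_mult[OF phi2_hom[OF R q2R]] phi2_const2)
    also have "\<dots> = phi2 R q2 G" by (simp add: F dF)
    also have "\<dots> = phi2 R q2 (subst2 R Q2 L)"
      using phi2_const2_mult[OF R q2R xy(2)] ph2[OF sL] c xy sL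
      by (simp add: G_def ring_hom_add[OF phi2_hom[OF R q2R]])
    also have "\<dots> = subst2 (quot R q2) (phi1 R q2 Q2) (phi2 R q2 L)"
      by (rule phi2_subst2[OF R q2R Q2 L])
    finally show "const2 (quot R q2) (phi R q2 d) \<otimes>\<^bsub>poly2 (quot R q2)\<^esub> phi2 R q2 F
        = subst2 (quot R q2) (phi1 R q2 Q2) (phi2 R q2 L)" .
  qed
  \<comment> \<open>The cycle i), ii), iii), i) closes: reduction gives ii) from i), and the two
    conditions of ii) imply those of iii) separately.\<close>
  show ?thesis
    using iii_i ii_iii_a ii_iii_b VA2_phi2[OF R q1R] VA2_phi2[OF R q2R] by blast
qed

end
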